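(* Suppose $T=(T_1,T_2)$ is a (commuting) 2-tuple of invertible operators on a complex Hilbert space $H$ and $c,d>0$. If $T$ lifts to a 2-tuple $J\in\mathfrak{J}_{c,d}$, then $\sigma_{\mathrm{Tay}}(T)\subset\sigma_{\mathrm{Tay}}(J)$. Moreover, in this case there exists a 2-tuple $\mathscr{J}\in\mathfrak{J}_{c,d}$ such that $T$ lifts to $\mathscr{J}$ and $\sigma_{\mathrm{Tay}}(T)=\sigma_{\mathrm{Tay}}(\mathscr{J})$.
   Context: All operators are bounded. $\sigma_{\mathrm{Tay}}(\cdot)$ denotes the Taylor joint spectrum of a commuting tuple of operators on a Hilbert space. A pair $J=(J_1,J_2)$ is in the class $\mathfrak{J}_{c,d}$ if there are commuting unitary operators $U_1,U_2$ on some Hilbert space $F$ such that, on $F\oplus F\oplus F$, $$J_1=\begin{pmatrix}U_1&cU_1&0\\0&U_1&0\\0&0&U_1\end{pmatrix},\qquad J_2=\begin{pmatrix}U_2&0&dU_2\\0&U_2&0\\0&0&U_2\end{pmatrix}.$$ A pair $(T_1,T_2)$ on $H$ lifts to $(J_1,J_2)$ on $K$ if there is an isometry $V:H\to K$ with $VT_i=J_iV$ for $i=1,2$. *)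

theory Defs
  imports "HOL-Analysis.Analysis"
begin

text \<open>
  Complex Hilbert spaces. The scalar product is linear in its first argument; its real part is
  the library's real scalar product, so that norm, topology and completeness are those of the
  library, and positive definiteness is inherited.
\<close>

class complex_hilbert = real_inner + complete_space +
  fixes scaleC :: "complex \<Rightarrow> 'a \<Rightarrow> 'a" (infixr "*\<^sub>C" 75)
    and cinner :: "'a \<Rightarrow> 'a \<Rightarrow> complex"
  assumes scaleC_add_right: "a *\<^sub>C (x + y) = a *\<^sub>C x + a *\<^sub>C y"
    and scaleC_add_left: "(a + b) *\<^sub>C x = a *\<^sub>C x + b *\<^sub>C x"
    and scaleC_scaleC: "a *\<^sub>C b *\<^sub>C x = (a * b) *\<^sub>C x"
    and scaleC_of_real: "complex_of_real r *\<^sub>C x = r *\<^sub>R x"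
    and cinner_commute: "cinner x y = cnj (cinner y x)"
    and cinner_add_left: "cinner (x + y) z = cinner x z + cinner y z"
    and cinner_scaleC_left: "cinner (a *\<^sub>C x) y = a * cinner x y"
    and Re_cinner: "Re (cinner x y) = inner x y"

instantiation complex :: complex_hilbert
begin

definition scaleC_complex_def: "a *\<^sub>C (x :: complex) = a * x"
definition cinner_complex_def: "cinner (x :: complex) y = x * cnj y"

instance
  by standard
    (simp_all add: scaleC_complex_def cinner_complex_def scaleR_conv_of_real inner_complex_def
      algebra_simps)

end

text \<open>
  The Hilbert space direct sum of two Hilbert spaces is their product type, whose norm in the
  library is the Euclidean one.
\<close>

instantiation prod :: (complex_hilbert, complex_hilbert) complex_hilbert
begin

definition scaleC_prod_def: "a *\<^sub>C p = (a *\<^sub>C fst p, a *\<^sub>C snd p)"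
definition cinner_prod_def: "cinner p q = cinner (fst p) (fst q) + cinner (snd p) (snd q)"

instance
proof
  fix p q :: "'a \<times> 'b"
  show "cinner p q = cnj (cinner q p)"
    unfolding cinner_prod_def complex_cnj_add by (metis cinner_commute)
qed (simp_all add: scaleC_prod_def cinner_prod_def scaleC_add_right scaleC_add_left scaleC_scaleC
      scaleC_of_real cinner_add_left cinner_scaleC_left Re_cinner inner_prod_def algebra_simps
      scaleR_prod_def)

end

text \<open>
  HOL cannot quantify existentially over types, so a Hilbert space is represented by a closed
  complex subspace of a type of class \<open>complex_hilbert\<close> (possibly the whole type). An operator
  is a total function of which only the values on that subspace matter.
\<close>

definition hilbert_space_on :: "'a::complex_hilbert set \<Rightarrow> bool" where
  "hilbert_space_on S \<longleftrightarrow>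
     0 \<in> S \<and> (\<forall>x\<in>S. \<forall>y\<in>S. x + y \<in> S) \<and> (\<forall>a. \<forall>x\<in>S. a *\<^sub>C x \<in> S) \<and> closed S"

definition clinear_between ::
  "'a::complex_hilbert set \<Rightarrow> 'b::complex_hilbert set \<Rightarrow> ('a \<Rightarrow> 'b) \<Rightarrow> bool" where
  "clinear_between S S' A \<longleftrightarrow>
     (\<forall>x\<in>S. A x \<in> S') \<and> (\<forall>x\<in>S. \<forall>y\<in>S. A (x + y) = A x + A y) \<and>
     (\<forall>a. \<forall>x\<in>S. A (a *\<^sub>C x) = a *\<^sub>C A x)"

definition operator_on :: "'a::complex_hilbert set \<Rightarrow> ('a \<Rightarrow> 'a) \<Rightarrow> bool" where
  "operator_on S A \<longleftrightarrow> clinear_between S S A \<and> (\<exists>B. \<forall>x\<in>S. norm (A x) \<le> B * norm x)"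

definition commute_on :: "'a set \<Rightarrow> ('a \<Rightarrow> 'a) \<Rightarrow> ('a \<Rightarrow> 'a) \<Rightarrow> bool" where
  "commute_on S A B \<longleftrightarrow> (\<forall>x\<in>S. A (B x) = B (A x))"

definition invertible_on :: "'a::complex_hilbert set \<Rightarrow> ('a \<Rightarrow> 'a) \<Rightarrow> bool" where
  "invertible_on S A \<longleftrightarrow>
     operator_on S A \<and> (\<exists>R. operator_on S R \<and> (\<forall>x\<in>S. R (A x) = x \<and> A (R x) = x))"

definition unitary_on :: "'a::complex_hilbert set \<Rightarrow> ('a \<Rightarrow> 'a) \<Rightarrow> bool" where
  "unitary_on S U \<longleftrightarrow>
     operator_on S U \<and> U ` S = S \<and> (\<forall>x\<in>S. \<forall>y\<in>S. cinner (U x) (U y) = cinner x y)"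

definition isometry_between ::
  "'a::complex_hilbert set \<Rightarrow> 'b::complex_hilbert set \<Rightarrow> ('a \<Rightarrow> 'b) \<Rightarrow> bool" where
  "isometry_between S S' V \<longleftrightarrow> clinear_between S S' V \<and> (\<forall>x\<in>S. norm (V x) = norm x)"

text \<open>
  Taylor spectrum of a pair: the Koszul complex of the pair \<open>(A, B)\<close> on \<open>S\<close> is
  \<open>0 \<rightarrow> S \<rightarrow> S \<oplus> S \<rightarrow> S \<rightarrow> 0\<close> with the two boundary maps below.
\<close>

definition koszul0 :: "('a \<Rightarrow> 'a) \<Rightarrow> ('a \<Rightarrow> 'a) \<Rightarrow> 'a \<Rightarrow> 'a \<times> 'a" where
  "koszul0 A B x = (A x, B x)"

definition koszul1 ::
  "('a::complex_hilbert \<Rightarrow> 'a) \<Rightarrow> ('a \<Rightarrow> 'a) \<Rightarrow> 'a \<times> 'a \<Rightarrow> 'a" where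
  "koszul1 A B p = A (snd p) - B (fst p)"

definition koszul_exact ::
  "'a::complex_hilbert set \<Rightarrow> ('a \<Rightarrow> 'a) \<Rightarrow> ('a \<Rightarrow> 'a) \<Rightarrow> bool" where
  "koszul_exact S A B \<longleftrightarrow>
     {x \<in> S. koszul0 A B x = 0} = {0} \<and>
     {p \<in> S \<times> S. koszul1 A B p = 0} = koszul0 A B ` S \<and>
     koszul1 A B ` (S \<times> S) = S"

definition taylor_spectrum ::
  "'a::complex_hilbert set \<Rightarrow> ('a \<Rightarrow> 'a) \<Rightarrow> ('a \<Rightarrow> 'a) \<Rightarrow> (complex \<times> complex) set" where
  "taylor_spectrum S T1 T2 =
     {(z1, z2). \<not> koszul_exact S (\<lambda>x. T1 x - z1 *\<^sub>C x) (\<lambda>x. T2 x - z2 *\<^sub>C x)}"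

text \<open>
  \<open>(x, y, z)\<close> stands for the column vector on which the block matrices of \<open>J1\<close> and \<open>J2\<close> act;
  nothing is required of \<open>J1\<close>, \<open>J2\<close> outside \<open>K\<close>.
\<close>

definition jordan_class ::
  "real \<Rightarrow> real \<Rightarrow> ('a \<times> 'a \<times> 'a) set \<Rightarrow> ('a::complex_hilbert \<times> 'a \<times> 'a \<Rightarrow> 'a \<times> 'a \<times> 'a) \<Rightarrow>
    ('a \<times> 'a \<times> 'a \<Rightarrow> 'a \<times> 'a \<times> 'a) \<Rightarrow> bool" where
  "jordan_class c d K J1 J2 \<longleftrightarrow>
     (\<exists>F U1 U2. hilbert_space_on F \<and> unitary_on F U1 \<and> unitary_on F U2 \<and> commute_on F U1 U2 \<and>
        K = F \<times> F \<times> F \<and>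
        (\<forall>x\<in>F. \<forall>y\<in>F. \<forall>z\<in>F.
           J1 (x, y, z) = (U1 x + c *\<^sub>R U1 y, U1 y, U1 z) \<and>
           J2 (x, y, z) = (U2 x + d *\<^sub>R U2 z, U2 y, U2 z)))"

definition lifts ::
  "'a::complex_hilbert set \<Rightarrow> ('a \<Rightarrow> 'a) \<Rightarrow> ('a \<Rightarrow> 'a) \<Rightarrow>
    'b::complex_hilbert set \<Rightarrow> ('b \<Rightarrow> 'b) \<Rightarrow> ('b \<Rightarrow> 'b) \<Rightarrow> bool" where
  "lifts H T1 T2 K J1 J2 \<longleftrightarrow>
     (\<exists>V. isometry_between H K V \<and>
        (\<forall>x\<in>H. V (T1 x) = J1 (V x) \<and> V (T2 x) = J2 (V x)))"

end

theory Submission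
  imports Defs
begin

text \<open>
  Let \<open>J\<close> be the Jordan pair of the commuting unitaries \<open>U1\<close>, \<open>U2\<close> on \<open>F\<close>. For a point \<open>z = (z1, z2)\<close>
  consider the nonnegative operator
  \<open>S(U) = (U1 - z1)\<^sup>*(U1 - z1) + (U2 - z2)\<^sup>*(U2 - z2)\<close>, the constant \<open>modsq\<close> below. As the adjoint of
  a unitary is its inverse, \<open>S\<close> is a Laurent polynomial, so \<open>S(T)\<close> and \<open>S(J)\<close> are defined as well and
  are intertwined by the lift. The operator \<open>S(J)\<close> is upper triangular with diagonal entries
  \<open>S(U)\<close>, and \<open>S(T)\<close> is a combination of \<open>T1 - z1\<close> and \<open>T2 - z2\<close> with commuting coefficients.
  Hence the Koszul complex of \<open>T - z\<close> is exact when \<open>S(T)\<close> is bijective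
  (\<open>koszul_exact_if_modsq_bijective\<close>).

  Suppose that \<open>z\<close> is not in the spectrum of \<open>J\<close>. Evaluating the Koszul complex on the vectors
  \<open>(x, 0, 0)\<close> shows that \<open>S(U)\<close> is coercive. After scaling the last two copies of \<open>F\<close> the
  off-diagonal entries of \<open>S(J)\<close> are negligible, so \<open>S(T)\<close> is coercive for an equivalent scalar
  product on \<open>H\<close>, and Lax--Milgram makes it bijective (\<open>shifted_modsq_bijective\<close>). This proves the
  inclusion of the spectra.

  Conversely, suppose that \<open>z\<close> is not in the spectrum of \<open>T\<close>. If \<open>z\<close> is not on the torus, \<open>S(U)\<close> is
  coercive anyway. Otherwise exactness makes \<open>S(T)\<close> bounded below (\<open>modsq_bounded_below\<close>) and, as
  \<open>S(T) + \<tau>\<close> is onto for every \<open>\<tau> > 0\<close>, bijective with \<open>\<parallel>S(T)\<^sup>-\<^sup>n\<parallel>\<close> at most \<open>e\<^sup>-\<^sup>n\<close> for some \<open>e > 0\<close>.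
  The components in \<open>F\<close> of a lifted vector therefore start backward orbits of \<open>S(U)\<close> whose norms
  are of order \<open>(n + 1) e\<^sup>-\<^sup>n\<close> at most. Norms along orbits of a symmetric operator are logarithmically convex, and this
  forces \<open>\<parallel>S(U) x\<parallel> \<ge> e \<parallel>x\<parallel>\<close> for the components \<open>x\<close> and on the whole reducing subspace of such
  vectors (\<open>backward_orbit_bounded_below\<close>). So the smallest reducing
  subspace that contains the components of all lifted vectors carries a Jordan pair whose spectrum
  omits every \<open>z\<close> outside the spectrum of \<open>T\<close>, and by the first part it omits no other point.
\<close>

instance complex_hilbert \<subseteq> banach ..

section \<open>Arithmetic in complex Hilbert spaces\<close>

lemma scaleC_zero_right [simp]: "a *\<^sub>C (0 :: 'a::complex_hilbert) = 0"
  using scaleC_add_right[of a 0 0] by simp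

lemma scaleC_minus_right: "a *\<^sub>C (- x :: 'a::complex_hilbert) = - (a *\<^sub>C x)"
  using scaleC_add_right[of a x "- x"] by (simp add: eq_neg_iff_add_eq_0 add.commute)

lemma scaleC_diff_right: "a *\<^sub>C (x - y :: 'a::complex_hilbert) = a *\<^sub>C x - a *\<^sub>C y"
  using scaleC_add_right[of a x "- y"] by (simp add: scaleC_minus_right)

lemma scaleC_scaleR_commute: "a *\<^sub>C r *\<^sub>R x = r *\<^sub>R a *\<^sub>C (x :: 'a::complex_hilbert)"
  by (simp add: scaleC_of_real[symmetric] scaleC_scaleC mult.commute)

lemma scaleC_commute: "a *\<^sub>C b *\<^sub>C x = b *\<^sub>C a *\<^sub>C (x :: 'a::complex_hilbert)"
  by (simp add: scaleC_scaleC mult.commute)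

lemma scaleC_minus_left: "(- a) *\<^sub>C x = - (a *\<^sub>C (x :: 'a::complex_hilbert))"
  using scaleC_scaleC[of "-1" a x] scaleC_of_real[of "-1" "a *\<^sub>C x"] by simp

lemma cinner_diff_left: "cinner (x - y) z = cinner x z - cinner (y :: 'a::complex_hilbert) z"
  using cinner_add_left[of "x - y" y z] by simp

lemma cinner_diff_right: "cinner z (x - y) = cinner z x - cinner z (y :: 'a::complex_hilbert)"
  by (metis cinner_commute cinner_diff_left complex_cnj_diff)

lemma cinner_scaleC_right: "cinner x (a *\<^sub>C y) = cnj a * cinner x (y :: 'a::complex_hilbert)"
  by (metis cinner_commute cinner_scaleC_left complex_cnj_mult)

lemma cinner_self: "cinner x x = complex_of_real ((norm (x :: 'a::complex_hilbert))\<^sup>2)"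
proof (rule complex_eqI)
  show "Re (cinner x x) = Re (complex_of_real ((norm x)\<^sup>2))"
    by (simp add: Re_cinner power2_norm_eq_inner)
  show "Im (cinner x x) = Im (complex_of_real ((norm x)\<^sup>2))"
    using arg_cong[OF cinner_commute[of x x], of Im] by simp
qed

lemma norm_scaleC: "norm (a *\<^sub>C x) = cmod a * norm (x :: 'a::complex_hilbert)"
proof -
  have "complex_of_real ((norm (a *\<^sub>C x))\<^sup>2) = cinner (a *\<^sub>C x) (a *\<^sub>C x)"
    by (simp only: cinner_self)
  also have "\<dots> = (a * cnj a) * cinner x x"
    by (simp only: cinner_scaleC_left cinner_scaleC_right mult_ac)
  also have "\<dots> = complex_of_real ((cmod a * norm x)\<^sup>2)"
    using complex_norm_square[of a] by (simp add: cinner_self power_mult_distrib)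
  finally have "(norm (a *\<^sub>C x))\<^sup>2 = (cmod a * norm x)\<^sup>2"
    by (simp only: of_real_eq_iff)
  then show ?thesis
    by (simp add: power2_eq_iff_nonneg)
qed

context
  fixes S :: "'a::complex_hilbert set"
  assumes S: "hilbert_space_on S"
begin

lemma hilbert_space_on_zero: "0 \<in> S"
  and hilbert_space_on_add: "x \<in> S \<Longrightarrow> y \<in> S \<Longrightarrow> x + y \<in> S"
  and hilbert_space_on_scaleC: "x \<in> S \<Longrightarrow> a *\<^sub>C x \<in> S"
  and hilbert_space_on_closed: "closed S"
  using S by (auto simp: hilbert_space_on_def)

lemma hilbert_space_on_scaleR: "x \<in> S \<Longrightarrow> r *\<^sub>R x \<in> S"
  using hilbert_space_on_scaleC[of x "complex_of_real r"] by (simp add: scaleC_of_real)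

lemma hilbert_space_on_minus: "x \<in> S \<Longrightarrow> - x \<in> S"
  using hilbert_space_on_scaleR[of x "-1"] by simp

lemma hilbert_space_on_diff: "x \<in> S \<Longrightarrow> y \<in> S \<Longrightarrow> x - y \<in> S"
  using hilbert_space_on_add[of x "- y"] hilbert_space_on_minus[of y] by simp

lemma hilbert_space_on_subspace: "subspace S"
  by (simp add: subspace_def hilbert_space_on_zero hilbert_space_on_add hilbert_space_on_scaleR)

lemmas hilbert_space_on_closure =
  hilbert_space_on_zero hilbert_space_on_add hilbert_space_on_scaleC hilbert_space_on_scaleR
  hilbert_space_on_minus hilbert_space_on_diff

end

context
  fixes S :: "'a::complex_hilbert set" and S' :: "'b::complex_hilbert set" and A
  assumes S: "hilbert_space_on S" and A: "clinear_between S S' A"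
begin

lemma clinear_between_in: "x \<in> S \<Longrightarrow> A x \<in> S'"
  and clinear_between_add: "x \<in> S \<Longrightarrow> y \<in> S \<Longrightarrow> A (x + y) = A x + A y"
  and clinear_between_scaleC: "x \<in> S \<Longrightarrow> A (a *\<^sub>C x) = a *\<^sub>C A x"
  using A by (auto simp: clinear_between_def)

lemma clinear_between_scaleR: "x \<in> S \<Longrightarrow> A (r *\<^sub>R x) = r *\<^sub>R A x"
  using clinear_between_scaleC[of x "complex_of_real r"] by (simp add: scaleC_of_real)

lemma clinear_between_minus: "x \<in> S \<Longrightarrow> A (- x) = - A x"
  using clinear_between_scaleR[of x "-1"] by simp

lemma clinear_between_diff: "x \<in> S \<Longrightarrow> y \<in> S \<Longrightarrow> A (x - y) = A x - A y"
  using clinear_between_add[of x "- y"] clinear_between_minus[of y]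
  by (simp add: hilbert_space_on_minus[OF S])

lemma clinear_between_zero: "A 0 = 0"
  using clinear_between_add[of 0 0] by (simp add: hilbert_space_on_zero[OF S])

lemmas clinear_between_arith =
  clinear_between_in clinear_between_add clinear_between_scaleC clinear_between_scaleR
  clinear_between_minus clinear_between_diff clinear_between_zero

end

lemma operator_on_clinear: "operator_on S A \<Longrightarrow> clinear_between S S A"
  by (simp add: operator_on_def)

lemma operator_on_bound:
  assumes "operator_on S A"
  obtains B where "B > 0" "\<And>x. x \<in> S \<Longrightarrow> norm (A x) \<le> B * norm x"
proof -
  from assms obtain B where B: "\<forall>x\<in>S. norm (A x) \<le> B * norm x"
    by (auto simp: operator_on_def)
  show thesis
  proof (rule that)
    show "max B 1 > 0" by simp
    show "norm (A x) \<le> max B 1 * norm x" if "x \<in> S" for x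
      using B that by (meson dual_order.trans max.cobounded1 mult_right_mono norm_ge_zero)
  qed
qed

lemma operator_onI:
  assumes "clinear_between S S A" "\<And>x. x \<in> S \<Longrightarrow> norm (A x) \<le> B * norm x"
  shows "operator_on S A"
  using assms by (auto simp: operator_on_def)

lemma operator_on_compose:
  assumes "operator_on S A" "operator_on S B"
  shows "operator_on S (\<lambda>x. A (B x))"
proof -
  obtain a where a: "a > 0" "\<And>x. x \<in> S \<Longrightarrow> norm (A x) \<le> a * norm x"
    using operator_on_bound[OF assms(1)] by blast
  obtain b where b: "b > 0" "\<And>x. x \<in> S \<Longrightarrow> norm (B x) \<le> b * norm x"
    using operator_on_bound[OF assms(2)] by blast
  have lin: "clinear_between S S A" "clinear_between S S B"
    using assms by (simp_all add: operator_on_def)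
  show ?thesis
  proof (rule operator_onI)
    show "clinear_between S S (\<lambda>x. A (B x))"
      using lin by (simp add: clinear_between_def)
    show "norm (A (B x)) \<le> (a * b) * norm x" if "x \<in> S" for x
    proof -
      have "norm (A (B x)) \<le> a * norm (B x)"
        using a(2) lin that by (simp add: clinear_between_def)
      also have "\<dots> \<le> a * (b * norm x)"
        using a(1) b(2)[OF that] by simp
      finally show ?thesis by (simp add: mult.assoc)
    qed
  qed
qed

lemma operator_on_scaleC:
  assumes S: "hilbert_space_on S" and A: "operator_on S A"
  shows "operator_on S (\<lambda>x. a *\<^sub>C A x)"
proof -
  obtain b where b: "b > 0" "\<And>x. x \<in> S \<Longrightarrow> norm (A x) \<le> b * norm x"
    using operator_on_bound[OF A] by blast
  show ?thesis
  proof (rule operator_onI)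
    show "clinear_between S S (\<lambda>x. a *\<^sub>C A x)"
      using operator_on_clinear[OF A] hilbert_space_on_scaleC[OF S]
      by (simp add: clinear_between_def scaleC_add_right scaleC_commute)
    show "norm (a *\<^sub>C A x) \<le> (cmod a * b) * norm x" if "x \<in> S" for x
      using mult_left_mono[OF b(2)[OF that], of "cmod a"] by (simp add: norm_scaleC mult.assoc)
  qed
qed

lemma operator_on_add:
  assumes S: "hilbert_space_on S" and A: "operator_on S A" and B: "operator_on S B"
  shows "operator_on S (\<lambda>x. A x + B x)"
proof -
  obtain a where a: "a > 0" "\<And>x. x \<in> S \<Longrightarrow> norm (A x) \<le> a * norm x"
    using operator_on_bound[OF A] by blast
  obtain b where b: "b > 0" "\<And>x. x \<in> S \<Longrightarrow> norm (B x) \<le> b * norm x"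
    using operator_on_bound[OF B] by blast
  show ?thesis
  proof (rule operator_onI)
    show "clinear_between S S (\<lambda>x. A x + B x)"
      using operator_on_clinear[OF A] operator_on_clinear[OF B] hilbert_space_on_add[OF S]
      by (simp add: clinear_between_def scaleC_add_right)
    show "norm (A x + B x) \<le> (a + b) * norm x" if "x \<in> S" for x
      using norm_triangle_ineq[of "A x" "B x"] a(2)[OF that] b(2)[OF that]
      by (simp add: distrib_right)
  qed
qed

lemma operator_on_ident: "operator_on S (\<lambda>x. x)"
  by (rule operator_onI[where B = 1]) (simp_all add: clinear_between_def)

lemma operator_on_shift:
  assumes S: "hilbert_space_on S" and A: "operator_on S A"
  shows "operator_on S (\<lambda>x. A x - a *\<^sub>C x)"
  using operator_on_add[OF S A operator_on_scaleC[OF S operator_on_ident, of "- a"]]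
  by (simp add: scaleC_minus_left)

lemma bounded_additive_continuous_on:
  fixes A :: "'a::real_normed_vector \<Rightarrow> 'b::real_normed_vector"
  assumes X: "subspace X"
    and add: "\<And>x y. x \<in> X \<Longrightarrow> y \<in> X \<Longrightarrow> A (x + y) = A x + A y"
    and bnd: "\<And>x. x \<in> X \<Longrightarrow> norm (A x) \<le> B * norm x"
  shows "continuous_on X A"
proof (rule Lipschitz.lipschitz_on_continuous_on[where L = "max B 0"])
  show "Lipschitz.lipschitz_on (max B 0) X A"
  proof (rule lipschitz_onI)
    fix x y assume xy: "x \<in> X" "y \<in> X"
    then have d: "x - y \<in> X" using X by (simp add: subspace_diff)
    have "A x - A y = A (x - y)" using add[OF d xy(2)] by simp
    then have "norm (A x - A y) \<le> B * norm (x - y)" using bnd[OF d] by simp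
    also have "\<dots> \<le> max B 0 * norm (x - y)" by (simp add: mult_right_mono)
    finally show "dist (A x) (A y) \<le> max B 0 * dist x y" by (simp add: dist_norm)
  qed simp
qed

section \<open>Solving operator equations by successive approximation\<close>

text \<open>
  If every right-hand side can be solved up to an error smaller by a fixed factor, summing the
  corrections gives an exact solution. The gauge \<open>p\<close> in which the error is measured need only
  dominate the norm up to a constant; this freedom is used for renormed spaces in \<open>surjective_if_coercive\<close>.
\<close>

lemma successive_approximation:
  fixes A :: "'a::banach \<Rightarrow> 'b::real_normed_vector" and p :: "'b \<Rightarrow> real"
  assumes X: "subspace X" "closed X"
    and add: "\<And>x y. x \<in> X \<Longrightarrow> y \<in> X \<Longrightarrow> A (x + y) = A x + A y"
    and bnd: "\<And>x. x \<in> X \<Longrightarrow> norm (A x) \<le> B * norm x"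
    and p: "\<And>y. y \<in> Y \<Longrightarrow> norm y \<le> m * p y"
    and q: "0 \<le> q" "q < 1" and k: "0 \<le> k" and m: "0 \<le> m"
    and step: "\<And>y. y \<in> Y \<Longrightarrow> \<exists>x\<in>X. norm x \<le> k * p y \<and> y - A x \<in> Y \<and> p (y - A x) \<le> q * p y"
    and y: "y \<in> Y"
  shows "\<exists>x\<in>X. A x = y \<and> norm x \<le> k * p y / (1 - q)"
proof -
  from step obtain f where f: "\<And>y. y \<in> Y \<Longrightarrow> f y \<in> X"
    "\<And>y. y \<in> Y \<Longrightarrow> norm (f y) \<le> k * p y"
    "\<And>y. y \<in> Y \<Longrightarrow> y - A (f y) \<in> Y" "\<And>y. y \<in> Y \<Longrightarrow> p (y - A (f y)) \<le> q * p y"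
    by metis
  define r where "r n = ((\<lambda>y. y - A (f y)) ^^ n) y" for n
  have r0: "r 0 = y" and rS: "r (Suc n) = r n - A (f (r n))" for n
    by (simp_all add: r_def)
  have rY: "r n \<in> Y" for n by (induction n) (simp_all add: r0 rS y f)
  have pr: "p (r n) \<le> q ^ n * p y" for n
  proof (induction n)
    case (Suc n)
    have "p (r (Suc n)) \<le> q * p (r n)" by (simp add: rS f rY)
    also have "\<dots> \<le> q * (q ^ n * p y)" using Suc q by (simp add: mult_left_mono)
    finally show ?case by (simp add: mult.assoc)
  qed (simp add: r0)
  define x where "x n = f (r n)" for n
  have xX: "x n \<in> X" for n by (simp add: x_def f rY)
  have nx: "norm (x n) \<le> k * p y * q ^ n" for n
  proof -
    have "norm (x n) \<le> k * p (r n)" by (simp add: x_def f rY)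
    also have "\<dots> \<le> k * (q ^ n * p y)" using pr k by (simp add: mult_left_mono)
    finally show ?thesis by (simp add: ac_simps)
  qed
  have geo: "(\<lambda>n. k * p y * q ^ n) sums (k * p y * (1 / (1 - q)))"
    using q by (intro sums_mult geometric_sums) simp
  have sn: "summable (\<lambda>n. norm (x n))"
    by (rule summable_comparison_test'[OF sums_summable[OF geo], of 0]) (simp add: nx)
  then have sx: "summable x" by (rule summable_norm_cancel)
  define s where "s = suminf x"
  have partX: "(\<Sum>i<n. x i) \<in> X" for n using xX X(1) by (simp add: subspace_sum)
  have lim: "(\<lambda>n. \<Sum>i<n. x i) \<longlonglongrightarrow> s" using sx by (simp add: s_def summable_LIMSEQ)
  have sX: "s \<in> X" using X(2) partX lim closed_sequentially by metis
  have part: "A (\<Sum>i<n. x i) = y - r n" for n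
  proof (induction n)
    case 0
    have "A 0 = 0" using add[of 0 0] subspace_0[OF X(1)] by simp
    then show ?case by (simp add: r0)
  next
    case (Suc n)
    then show ?case using partX xX by (simp add: add rS x_def)
  qed
  have "(\<lambda>n. A (\<Sum>i<n. x i)) \<longlonglongrightarrow> A s"
    using bounded_additive_continuous_on[OF X(1) add bnd] lim sX partX
    by (auto simp: continuous_on_sequentially o_def)
  moreover have "(\<lambda>n. A (\<Sum>i<n. x i)) \<longlonglongrightarrow> y"
  proof -
    have "r \<longlonglongrightarrow> 0"
    proof (rule Lim_null_comparison)
      have "norm (r n) \<le> m * (q ^ n * p y)" for n
        using p[OF rY[of n]] mult_left_mono[OF pr[of n] m] by linarith
      then show "\<forall>\<^sub>F n in sequentially. norm (r n) \<le> m * (q ^ n * p y)" by simp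
      have "(\<lambda>n. m * (q ^ n * p y)) \<longlonglongrightarrow> m * (0 * p y)"
        using q by (intro tendsto_intros LIMSEQ_power_zero) simp
      then show "(\<lambda>n. m * (q ^ n * p y)) \<longlonglongrightarrow> 0" by simp
    qed
    then show ?thesis unfolding part using tendsto_diff[OF tendsto_const[of y]] by fastforce
  qed
  ultimately have "A s = y" by (rule LIMSEQ_unique)
  moreover have "norm s \<le> k * p y / (1 - q)"
  proof -
    have "norm s \<le> (\<Sum>n. norm (x n))" unfolding s_def by (rule summable_norm[OF sn])
    also have "\<dots> \<le> (\<Sum>n. k * p y * q ^ n)"
      by (rule suminf_le[OF nx sn sums_summable[OF geo]])
    also have "\<dots> = k * p y / (1 - q)" using sums_unique[OF geo] by simp
    finally show ?thesis .
  qed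
  ultimately show ?thesis using sX by blast
qed

text \<open>
  The bounded inverse theorem for operators between closed subspaces. Baire's theorem in the range
  provides one ball contained in the closure of the image of a ball; by symmetry and convexity the
  ball may be centred at \<open>0\<close>, so every vector in the range has an approximate preimage of
  comparable norm.
\<close>

lemma bounded_below_if_injective_closed_range:
  fixes A :: "'a::banach \<Rightarrow> 'b::banach"
  assumes X: "subspace X" "closed X" and Y: "closed (A ` X)"
    and add: "\<And>x y. x \<in> X \<Longrightarrow> y \<in> X \<Longrightarrow> A (x + y) = A x + A y"
    and scale: "\<And>r x. x \<in> X \<Longrightarrow> A (r *\<^sub>R x) = r *\<^sub>R A x"
    and bnd: "\<And>x. x \<in> X \<Longrightarrow> norm (A x) \<le> B * norm x"
    and inj: "\<And>x. x \<in> X \<Longrightarrow> A x = 0 \<Longrightarrow> x = 0"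
  shows "\<exists>e>0. \<forall>x\<in>X. e * norm x \<le> norm (A x)"
proof -
  define D where "D n = closure (A ` (X \<inter> cball 0 (real n)))" for n
  have Dsub: "D n \<subseteq> A ` X" for n
    unfolding D_def by (rule closure_minimal[OF _ Y]) auto
  have cover: "\<Union> (range D) = A ` X"
  proof
    show "A ` X \<subseteq> \<Union> (range D)"
    proof
      fix y assume "y \<in> A ` X"
      then obtain x where x: "x \<in> X" "y = A x" by blast
      obtain n where "norm x \<le> real n" using real_arch_simple by blast
      then have "y \<in> D n" using x closure_subset unfolding D_def by fastforce
      then show "y \<in> \<Union> (range D)" by blast
    qed
  qed (use Dsub in blast)
  have "\<exists>n. top_of_set (A ` X) interior_of D n \<noteq> {}"
  proof (rule ccontr)
    assume contr: "\<not> (\<exists>n. top_of_set (A ` X) interior_of D n \<noteq> {})"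
    then have "top_of_set (A ` X) interior_of \<Union> (range D) = {}"
    proof (intro Baire_category_alt)
      show "completely_metrizable_space (top_of_set (A ` X)) \<or>
          locally_compact_space (top_of_set (A ` X)) \<and> regular_space (top_of_set (A ` X))"
        using Y closed_closedin completely_metrizable_space_closedin
          completely_metrizable_space_euclidean by blast
      show "countable (range D)" by simp
      fix T assume "T \<in> range D"
      then obtain n where n: "T = D n" by blast
      have "closedin (top_of_set (A ` X)) T"
        unfolding n using Dsub[of n] by (intro closed_subset) (auto simp: D_def)
      then show "closedin (top_of_set (A ` X)) T \<and> top_of_set (A ` X) interior_of T = {}"
        using contr n by blast
    qed
    then have "A ` X = {}" unfolding cover
      by (metis interior_of_topspace topspace_euclidean_subtopology)
    then show False using subspace_0[OF X(1)] by blast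
  qed
  then obtain n y0 U where U: "openin (top_of_set (A ` X)) U" "y0 \<in> U" "U \<subseteq> D n"
    by (auto simp: interior_of_def)
  then obtain r where r: "r > 0" "ball y0 r \<inter> A ` X \<subseteq> U"
    by (auto simp: openin_contains_ball)
  have y0: "y0 \<in> A ` X" using U openin_subset by fastforce
  have A0: "A 0 = 0" using add[of 0 0] subspace_0[OF X(1)] by simp
  have Amin: "A (- x) = - A x" if "x \<in> X" for x using scale[OF that, of "-1"] by simp
  have sub: "subspace (A ` X)"
    unfolding subspace_def
  proof (intro conjI ballI allI)
    show "0 \<in> A ` X" using A0 subspace_0[OF X(1)] by (metis imageI)
    show "x + y \<in> A ` X" if "x \<in> A ` X" "y \<in> A ` X" for x y
      using that add subspace_add[OF X(1)] by (smt (verit) imageE imageI)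
    show "c *\<^sub>R x \<in> A ` X" if "x \<in> A ` X" for c x
      using that scale subspace_scale[OF X(1)] by (smt (verit) imageE imageI)
  qed
  have small: "\<exists>x\<in>X. norm x \<le> real n \<and> norm (y - A x) < e"
    if y: "y \<in> A ` X" "norm y < r" and e: "e > 0" for y e
  proof -
    have "y0 + y \<in> ball y0 r \<inter> A ` X" "y0 - y \<in> ball y0 r \<inter> A ` X"
      using y y0 sub by (simp_all add: subspace_add subspace_diff dist_norm)
    then have "y0 + y \<in> D n" "y0 - y \<in> D n"
      using r(2) U(3) by blast+
    then have "\<exists>w\<in>A ` (X \<inter> cball 0 (real n)). dist w (y0 + y) < e"
      "\<exists>w\<in>A ` (X \<inter> cball 0 (real n)). dist w (y0 - y) < e"
      unfolding D_def closure_approachable using e by simp_all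
    then obtain u v where u: "u \<in> X" "norm u \<le> real n" "dist (A u) (y0 + y) < e"
      and v: "v \<in> X" "norm v \<le> real n" "dist (A v) (y0 - y) < e"
      by auto
    define x where "x = (1/2) *\<^sub>R (u + - v)"
    have mX: "u + - v \<in> X" using u v X(1) by (simp add: subspace_diff)
    have "A x = (1/2) *\<^sub>R (A u - A v)"
      using mX u v X(1) by (simp add: x_def scale add Amin subspace_neg del: add_uminus_conv_diff)
    then have "2 *\<^sub>R A x = A u - A v" by simp
    then have "2 *\<^sub>R (y - A x) = ((y0 + y) - A u) - ((y0 - y) - A v)"
      by (simp add: scaleR_diff_right scaleR_2)
    then have "2 * norm (y - A x) = norm (((y0 + y) - A u) - ((y0 - y) - A v))"
      by (metis abs_numeral norm_scaleR)
    also have "\<dots> \<le> norm ((y0 + y) - A u) + norm ((y0 - y) - A v)" by (rule norm_triangle_ineq4)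
    also have "\<dots> < e + e" using u(3) v(3) by (intro add_strict_mono) (simp_all add: dist_norm norm_minus_commute)
    finally have "norm (y - A x) < e" by simp
    moreover have "norm x \<le> real n"
      using norm_triangle_ineq4[of u v] u(2) v(2) by (simp add: x_def)
    moreover have "x \<in> X" using mX X(1) by (simp add: x_def subspace_scale)
    ultimately show ?thesis by blast
  qed
  define k where "k = 2 * real n / r"
  have k: "k \<ge> 0" using r by (simp add: k_def)
  have step: "\<exists>x\<in>X. norm x \<le> k * norm y \<and> y - A x \<in> A ` X \<and> norm (y - A x) \<le> 1/2 * norm y"
    if y: "y \<in> A ` X" for y
  proof (cases "y = 0")
    case True
    then show ?thesis using subspace_0[OF X(1)] A0 y by (intro bexI[of _ 0]) auto
  next
    case False
    define t where "t = r / (2 * norm y)"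
    have t: "t > 0" using r False by (simp add: t_def)
    have "t *\<^sub>R y \<in> A ` X" "norm (t *\<^sub>R y) < r" "r / 4 > 0"
      using y sub r False by (auto simp: subspace_scale t_def)
    then obtain x where x: "x \<in> X" "norm x \<le> real n" "norm (t *\<^sub>R y - A x) < r / 4"
      using small by blast
    define w where "w = (1 / t) *\<^sub>R x"
    have w: "w \<in> X" using x X(1) by (simp add: w_def subspace_scale)
    have "norm w \<le> k * norm y"
      using x(2) t r False by (simp add: w_def t_def k_def field_simps)
    moreover have "y - A w = (1 / t) *\<^sub>R (t *\<^sub>R y - A x)"
      using t x by (simp add: w_def scale algebra_simps)
    then have "norm (y - A w) = (1 / t) * norm (t *\<^sub>R y - A x)" using t by simp
    then have "norm (y - A w) \<le> (1 / t) * (r / 4)" using mult_left_mono[of _ "r / 4" "1 / t", OF less_imp_le[OF x(3)]] t by simp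
    then have "norm (y - A w) \<le> 1/2 * norm y" using r False by (simp add: t_def)
    moreover have "y - A w \<in> A ` X" using y w sub by (simp add: subspace_diff)
    ultimately show ?thesis using w by blast
  qed
  show ?thesis
  proof (intro exI conjI ballI)
    show "1 / (2 * k + 1) > 0" using k by simp
    fix x assume x: "x \<in> X"
    have "\<exists>x'\<in>X. A x' = A x \<and> norm x' \<le> k * norm (A x) / (1 - 1/2)"
    proof (rule successive_approximation[OF X add bnd _ _ _ k _ step])
      show "norm y \<le> 1 * norm y" for y :: 'b by simp
    qed (use x in simp_all)
    then obtain x' where x': "x' \<in> X" "A x' = A x" "norm x' \<le> k * norm (A x) / (1 - 1/2)"
      by blast
    have "A (x + - x') = 0" using x x' X(1) by (simp add: add Amin subspace_neg del: add_uminus_conv_diff)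
    then have "x = x'" using inj[of "x + - x'"] x x' X(1) by (simp add: subspace_diff)
    then have "norm x \<le> 2 * k * norm (A x)" using x' by simp
    also have "\<dots> \<le> (2 * k + 1) * norm (A x)" by (simp add: mult_right_mono)
    finally show "1 / (2 * k + 1) * norm x \<le> norm (A x)" using k by (simp add: pos_divide_le_eq mult.commute)
  qed
qed

text \<open>
  The Lax--Milgram theorem with respect to the scalar product pulled back along \<open>W\<close>, whose norm is
  equivalent to the given one. Coercivity makes \<open>1 - s A\<close> a strict contraction for small \<open>s > 0\<close>, so
  \<open>s y\<close> solves \<open>A x = y\<close> up to a smaller error.
\<close>

lemma surjective_if_coercive:
  fixes A :: "'a::banach \<Rightarrow> 'a" and W :: "'a \<Rightarrow> 'b::real_inner"
  assumes X: "subspace X" "closed X"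
    and A_in: "\<And>x. x \<in> X \<Longrightarrow> A x \<in> X"
    and add: "\<And>x y. x \<in> X \<Longrightarrow> y \<in> X \<Longrightarrow> A (x + y) = A x + A y"
    and scale: "\<And>r x. x \<in> X \<Longrightarrow> A (r *\<^sub>R x) = r *\<^sub>R A x"
    and bnd: "\<And>x. x \<in> X \<Longrightarrow> norm (A x) \<le> B * norm x"
    and W_diff: "\<And>x y. x \<in> X \<Longrightarrow> y \<in> X \<Longrightarrow> W (x - y) = W x - W y"
    and W_scale: "\<And>r x. x \<in> X \<Longrightarrow> W (r *\<^sub>R x) = r *\<^sub>R W x"
    and W_low: "\<And>x. x \<in> X \<Longrightarrow> norm x \<le> m * norm (W x)"
    and W_up: "\<And>x. x \<in> X \<Longrightarrow> norm (W x) \<le> M * norm x"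
    and coercive: "\<And>x. x \<in> X \<Longrightarrow> e * (norm (W x))\<^sup>2 \<le> inner (W (A x)) (W x)"
    and pos: "e > 0" "m > 0" "M > 0" "B > 0"
  shows "A ` X = X"
proof
  define L where "L = M * B * m"
  have L: "L > 0" using pos by (simp add: L_def)
  have WA: "norm (W (A x)) \<le> L * norm (W x)" if "x \<in> X" for x
  proof -
    have "norm (W (A x)) \<le> M * norm (A x)" by (rule W_up[OF A_in[OF that]])
    also have "\<dots> \<le> M * (B * norm x)" using bnd[OF that] pos by simp
    also have "\<dots> \<le> M * (B * (m * norm (W x)))" using W_low[OF that] pos by simp
    finally show ?thesis by (simp add: L_def mult.assoc)
  qed
  \<comment> \<open>The choice \<open>s = e / L'\<^sup>2\<close> minimizes \<open>1 - 2 s e + s\<^sup>2 L'\<^sup>2\<close>; enlarging \<open>L\<close> to \<open>L'\<close> keeps the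
    minimum \<open>1 - (e / L')\<^sup>2\<close> positive.\<close>
  define L' where "L' = L + e"
  define s where "s = e / L'\<^sup>2"
  define q where "q = sqrt (1 - (e / L')\<^sup>2)"
  have eL: "0 < e / L'" "e / L' < 1" using pos L by (simp_all add: L'_def)
  have sq: "0 < (e / L')\<^sup>2" "(e / L')\<^sup>2 < 1"
    using eL by (auto intro: zero_less_power power_less_one_iff[THEN iffD2] simp del: power_divide)
  have q: "0 \<le> q" "q < 1" using sq by (simp_all add: q_def)
  have s: "s > 0" using pos L by (simp add: s_def L'_def)
  have contract: "norm (W (x - s *\<^sub>R A x)) \<le> q * norm (W x)" if x: "x \<in> X" for x
  proof (rule power2_le_imp_le)
    have "W (x - s *\<^sub>R A x) = W x - s *\<^sub>R W (A x)"
      using x A_in[OF x] X(1) by (simp add: W_diff W_scale subspace_scale)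
    moreover have "(norm (a - s *\<^sub>R b))\<^sup>2 = (norm a)\<^sup>2 - 2 * s * inner b a + s\<^sup>2 * (norm b)\<^sup>2"
      for a b :: 'b
      unfolding power2_norm_eq_inner
      by (simp add: inner_diff_left inner_diff_right inner_commute power2_eq_square algebra_simps)
    ultimately have "(norm (W (x - s *\<^sub>R A x)))\<^sup>2
        = (norm (W x))\<^sup>2 - 2 * s * inner (W (A x)) (W x) + s\<^sup>2 * (norm (W (A x)))\<^sup>2"
      by simp
    also have "\<dots> \<le> (norm (W x))\<^sup>2 - 2 * s * (e * (norm (W x))\<^sup>2) + s\<^sup>2 * (L' * norm (W x))\<^sup>2"
    proof -
      have "(norm (W (A x)))\<^sup>2 \<le> (L' * norm (W x))\<^sup>2"
        using WA[OF x] pos by (intro power_mono) (auto simp: L'_def distrib_right intro: add_increasing2)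
      then have "s\<^sup>2 * (norm (W (A x)))\<^sup>2 \<le> s\<^sup>2 * (L' * norm (W x))\<^sup>2" by (simp add: mult_left_mono)
      moreover have "s * (e * (norm (W x))\<^sup>2) \<le> s * inner (W (A x)) (W x)"
        using coercive[OF x] s by simp
      ultimately show ?thesis by linarith
    qed
    also have "\<dots> = (q * norm (W x))\<^sup>2"
    proof -
      have L': "L' > 0" using L pos by (simp add: L'_def)
      have "q\<^sup>2 = 1 - (e / L')\<^sup>2" unfolding q_def using sq by (intro real_sqrt_pow2) linarith
      moreover have "s * e = (e / L')\<^sup>2" "s\<^sup>2 * L'\<^sup>2 = (e / L')\<^sup>2"
        using L' by (simp_all add: s_def power2_eq_square)
      ultimately have "q\<^sup>2 = 1 - 2 * (s * e) + s\<^sup>2 * L'\<^sup>2" by linarith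
      then have "(q * norm (W x))\<^sup>2 = (1 - 2 * (s * e) + s\<^sup>2 * L'\<^sup>2) * (norm (W x))\<^sup>2"
        by (simp only: power_mult_distrib)
      also have "\<dots> = (norm (W x))\<^sup>2 - 2 * s * (e * (norm (W x))\<^sup>2) + s\<^sup>2 * (L' * norm (W x))\<^sup>2"
        by (simp only: power_mult_distrib) (simp only: algebra_simps)
      finally show ?thesis by simp
    qed
    finally show "(norm (W (x - s *\<^sub>R A x)))\<^sup>2 \<le> (q * norm (W x))\<^sup>2" .
    show "0 \<le> q * norm (W x)" using q by simp
  qed
  show "X \<subseteq> A ` X"
  proof
    fix y assume y: "y \<in> X"
    have "\<exists>x\<in>X. A x = y \<and> norm x \<le> (s * m) * norm (W y) / (1 - q)"
    proof (rule successive_approximation[OF X add bnd W_low q _ _ _ y])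
      show "0 \<le> s * m" "0 \<le> m" using s pos by simp_all
      fix z assume z: "z \<in> X"
      show "\<exists>x\<in>X. norm x \<le> s * m * norm (W z) \<and> z - A x \<in> X \<and> norm (W (z - A x)) \<le> q * norm (W z)"
        using z X(1) W_low[OF z] contract[OF z] A_in[OF z] s
        by (intro bexI[of _ "s *\<^sub>R z"]) (simp_all add: scale subspace_scale subspace_diff)
    qed
    then show "y \<in> A ` X" by blast
  qed
  show "A ` X \<subseteq> X" using A_in by (rule image_subsetI)
qed

section \<open>Koszul exactness and the joint squared modulus\<close>

text \<open>
  In terms of spectra: \<open>(0, 0)\<close> is not in the joint approximate point spectrum of the pair.
\<close>

definition jointly_bounded_below ::
  "'a::complex_hilbert set \<Rightarrow> ('a \<Rightarrow> 'a) \<Rightarrow> ('a \<Rightarrow> 'a) \<Rightarrow> bool" where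
  "jointly_bounded_below S A B \<longleftrightarrow>
     (\<exists>e>0. \<forall>x\<in>S. e * (norm x)\<^sup>2 \<le> (norm (A x))\<^sup>2 + (norm (B x))\<^sup>2)"

text \<open>
  The first Koszul map is injective, and exactness in the middle makes its range the kernel of a
  continuous map, hence closed.
\<close>

lemma koszul_exact_imp_jointly_bounded_below:
  assumes S: "hilbert_space_on S" and A: "operator_on S A" and B: "operator_on S B"
    and ex: "koszul_exact S A B"
  shows "jointly_bounded_below S A B"
proof -
  note subS = hilbert_space_on_subspace[OF S]
  note linA = clinear_between_arith[OF S operator_on_clinear[OF A]]
  note linB = clinear_between_arith[OF S operator_on_clinear[OF B]]
  obtain a where a: "a > 0" "\<And>x. x \<in> S \<Longrightarrow> norm (A x) \<le> a * norm x"
    using operator_on_bound[OF A] by blast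
  obtain b where b: "b > 0" "\<And>x. x \<in> S \<Longrightarrow> norm (B x) \<le> b * norm x"
    using operator_on_bound[OF B] by blast
  have "\<exists>e>0. \<forall>x\<in>S. e * norm x \<le> norm (koszul0 A B x)"
  proof (rule bounded_below_if_injective_closed_range[OF subS hilbert_space_on_closed[OF S]])
    have contA: "continuous_on S A"
      by (rule bounded_additive_continuous_on[OF subS linA(2) a(2)])
    have contB: "continuous_on S B"
      by (rule bounded_additive_continuous_on[OF subS linB(2) b(2)])
    have "closed {p \<in> S \<times> S. koszul1 A B p \<in> {0}}"
    proof (rule continuous_closed_preimage[unfolded vimage_def Int_def mem_Collect_eq])
      show "continuous_on (S \<times> S) (koszul1 A B)"
        unfolding koszul1_def
        by (intro continuous_intros continuous_on_compose2[OF contA] continuous_on_compose2[OF contB]) auto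
    qed (use hilbert_space_on_closed[OF S] in \<open>auto intro: closed_Times\<close>)
    moreover have "{p \<in> S \<times> S. koszul1 A B p = 0} = koszul0 A B ` S"
      using ex unfolding koszul_exact_def by blast
    ultimately show "closed (koszul0 A B ` S)" by simp
    show "koszul0 A B (x + y) = koszul0 A B x + koszul0 A B y" if "x \<in> S" "y \<in> S" for x y
      using that by (simp add: koszul0_def linA linB)
    show "koszul0 A B (r *\<^sub>R x) = r *\<^sub>R koszul0 A B x" if "x \<in> S" for r x
      using that by (simp add: koszul0_def linA linB)
    show "norm (koszul0 A B x) \<le> (a + b) * norm x" if "x \<in> S" for x
      using norm_Pair_le[of "A x" "B x"] a(2)[OF that] b(2)[OF that]
      by (simp add: koszul0_def distrib_right)
    show "x = 0" if "x \<in> S" "koszul0 A B x = 0" for x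
      using that ex unfolding koszul_exact_def by blast
  qed
  then obtain e where e: "e > 0" "\<And>x. x \<in> S \<Longrightarrow> e * norm x \<le> norm (koszul0 A B x)" by blast
  have "e\<^sup>2 * (norm x)\<^sup>2 \<le> (norm (A x))\<^sup>2 + (norm (B x))\<^sup>2" if "x \<in> S" for x
    using power_mono[OF e(2)[OF that], of 2] e(1)
    by (simp add: koszul0_def norm_Pair power_mult_distrib)
  then show ?thesis
    unfolding jointly_bounded_below_def using e(1) by (intro exI[of _ "e\<^sup>2"]) simp
qed

text \<open>
  For a unitary \<open>T\<close> with inverse \<open>R\<close> this is \<open>(T - z)\<^sup>*(T - z)\<close>. Writing \<open>R\<close> for the adjoint turns it
  into the Laurent polynomial \<open>1 + |z|\<^sup>2 - cnj z w - z / w\<close> evaluated at \<open>T\<close>, which agrees with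
  \<open>|w - z|\<^sup>2\<close> on the unit circle, makes sense for every invertible operator and is respected by
  intertwining maps.
\<close>

definition modulus_square ::
  "('a::complex_hilbert \<Rightarrow> 'a) \<Rightarrow> ('a \<Rightarrow> 'a) \<Rightarrow> complex \<Rightarrow> 'a \<Rightarrow> 'a" where
  "modulus_square T R z x = R (T x - z *\<^sub>C x) - cnj z *\<^sub>C (T x - z *\<^sub>C x)"

text \<open>
  The logarithmic derivative \<open>w d/dw\<close> of \<open>1 + |z|\<^sup>2 - cnj z w - z / w\<close>, evaluated at \<open>T\<close>. Times
  \<open>c\<close>, it is the off-diagonal entry of this function of the Jordan block with entries \<open>T\<close> on and
  \<open>c T\<close> above the diagonal.
\<close>

definition angular_derivative ::
  "('a::complex_hilbert \<Rightarrow> 'a) \<Rightarrow> ('a \<Rightarrow> 'a) \<Rightarrow> complex \<Rightarrow> 'a \<Rightarrow> 'a" where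
  "angular_derivative T R z x = z *\<^sub>C R x - cnj z *\<^sub>C T x"

locale inverse_operators =
  fixes S :: "'a::complex_hilbert set" and T R :: "'a \<Rightarrow> 'a"
  assumes space: "hilbert_space_on S"
    and T_op: "operator_on S T" and R_op: "operator_on S R"
    and R_T [simp]: "x \<in> S \<Longrightarrow> R (T x) = x" and T_R [simp]: "x \<in> S \<Longrightarrow> T (R x) = x"
begin

lemmas space_simps [simp] = hilbert_space_on_closure[OF space]
lemmas T_simps [simp] = clinear_between_arith[OF space operator_on_clinear[OF T_op]]
lemmas R_simps [simp] = clinear_between_arith[OF space operator_on_clinear[OF R_op]]

lemma shift_op: "operator_on S (\<lambda>x. T x - z *\<^sub>C x)"
  by (rule operator_on_shift[OF space T_op])

lemma inverse_shift_op: "operator_on S (\<lambda>x. R x - z *\<^sub>C x)"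
  by (rule operator_on_shift[OF space R_op])

lemma modulus_square_op: "operator_on S (modulus_square T R z)"
  using operator_on_compose[OF inverse_shift_op shift_op]
  by (simp add: modulus_square_def[abs_def])

lemma angular_derivative_op: "operator_on S (angular_derivative T R z)"
  using operator_on_add[OF space operator_on_scaleC[OF space R_op]
      operator_on_scaleC[OF space T_op], of z "- cnj z"]
  by (simp add: angular_derivative_def[abs_def] scaleC_minus_left)

lemma modulus_square_expand:
  "x \<in> S \<Longrightarrow> modulus_square T R z x = x - z *\<^sub>C R x - cnj z *\<^sub>C T x + (cnj z * z) *\<^sub>C x"
  by (simp add: modulus_square_def scaleC_diff_right scaleC_scaleC)

lemma inverse_commute:
  assumes C: "\<And>x. x \<in> S \<Longrightarrow> C x \<in> S" "\<And>x. x \<in> S \<Longrightarrow> C (T x) = T (C x)" and x: "x \<in> S"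
  shows "C (R x) = R (C x)"
  using C(2)[of "R x"] C(1)[of "R x"] x by (metis R_T R_simps(1) T_R)

lemma modulus_square_commute:
  assumes C: "clinear_between S S C" "\<And>x. x \<in> S \<Longrightarrow> C (T x) = T (C x)" and x: "x \<in> S"
  shows "C (modulus_square T R z x) = modulus_square T R z (C x)"
proof -
  note linC = clinear_between_arith[OF space C(1)]
  show ?thesis
    using x linC(1)[OF x] inverse_commute[of C x, OF linC(1) C(2)]
    by (simp add: modulus_square_expand linC C(2))
qed

lemma angular_derivative_commute:
  assumes C: "clinear_between S S C" "\<And>x. x \<in> S \<Longrightarrow> C (T x) = T (C x)" and x: "x \<in> S"
  shows "C (angular_derivative T R z x) = angular_derivative T R z (C x)"
proof -
  note linC = clinear_between_arith[OF space C(1)]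
  show ?thesis
    using x inverse_commute[of C x, OF linC(1) C(2)]
    by (simp add: angular_derivative_def linC C(2))
qed

end

locale commuting_inverses =
  o1: inverse_operators S T1 R1 + o2: inverse_operators S T2 R2
  for S :: "'a::complex_hilbert set" and T1 R1 T2 R2 +
  assumes commute: "x \<in> S \<Longrightarrow> T1 (T2 x) = T2 (T1 x)"
begin

definition modsq :: "complex \<Rightarrow> complex \<Rightarrow> 'a \<Rightarrow> 'a" where
  "modsq z1 z2 x = modulus_square T1 R1 z1 x + modulus_square T2 R2 z2 x"

lemma modsq_op: "operator_on S (modsq z1 z2)"
  using operator_on_add[OF o1.space o1.modulus_square_op o2.modulus_square_op]
  by (simp add: modsq_def[abs_def])

lemmas modsq_simps [simp] = clinear_between_arith[OF o1.space operator_on_clinear[OF modsq_op]]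

lemma commutants:
  assumes x: "x \<in> S"
  shows "T1 (R2 x) = R2 (T1 x)" "T2 (R1 x) = R1 (T2 x)" "R1 (R2 x) = R2 (R1 x)"
proof -
  have *: "T1 (R2 x) = R2 (T1 x)" "T2 (R1 x) = R1 (T2 x)" if "x \<in> S" for x
    using that commute by (simp_all add: o1.inverse_commute o2.inverse_commute)
  show "T1 (R2 x) = R2 (T1 x)" "T2 (R1 x) = R1 (T2 x)" by (rule *[OF x])+
  show "R1 (R2 x) = R2 (R1 x)"
    using o1.inverse_commute[of R2 x] * x by simp
qed

lemma modsq_commute:
  assumes C: "clinear_between S S C" "\<And>x. x \<in> S \<Longrightarrow> C (T1 x) = T1 (C x)"
    "\<And>x. x \<in> S \<Longrightarrow> C (T2 x) = T2 (C x)" and x: "x \<in> S"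
  shows "C (modsq z1 z2 x) = modsq z1 z2 (C x)"
proof -
  have "modulus_square T1 R1 z1 x \<in> S" "modulus_square T2 R2 z2 x \<in> S"
    using x operator_on_clinear[OF o1.modulus_square_op] operator_on_clinear[OF o2.modulus_square_op]
    by (simp_all add: clinear_between_def)
  then show ?thesis
    using clinear_between_add[OF o1.space C(1)]
      o1.modulus_square_commute[OF C(1,2) x] o2.modulus_square_commute[OF C(1,3) x]
    by (simp add: modsq_def)
qed

text \<open>
  Write \<open>modsq = B1 N1 + B2 N2\<close> with \<open>N1\<close>, \<open>N2\<close> the two shifted operators and all four factors
  commuting. A bijective combination of this kind is a contracting homotopy of the Koszul complex up
  to the inverse of \<open>modsq\<close>: given \<open>N1 q = N2 p\<close>, the solution \<open>x\<close> of \<open>modsq x = B1 p + B2 q\<close>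
  satisfies \<open>N1 x = p\<close> and \<open>N2 x = q\<close>.
\<close>

lemma koszul_exact_if_modsq_bijective:
  assumes onto: "modsq z1 z2 ` S = S" and inj: "\<And>x. x \<in> S \<Longrightarrow> modsq z1 z2 x = 0 \<Longrightarrow> x = 0"
  shows "koszul_exact S (\<lambda>x. T1 x - z1 *\<^sub>C x) (\<lambda>x. T2 x - z2 *\<^sub>C x)"
proof -
  define N1 N2 where "N1 x = T1 x - z1 *\<^sub>C x" and "N2 x = T2 x - z2 *\<^sub>C x" for x
  define B1 B2 where "B1 x = R1 x - cnj z1 *\<^sub>C x" and "B2 x = R2 x - cnj z2 *\<^sub>C x" for x
  have ops: "operator_on S N1" "operator_on S N2" "operator_on S B1" "operator_on S B2"
    using o1.shift_op o2.shift_op o1.inverse_shift_op o2.inverse_shift_op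
    by (simp_all add: N1_def[abs_def] N2_def[abs_def] B1_def[abs_def] B2_def[abs_def])
  note [simp] = clinear_between_arith[OF o1.space operator_on_clinear[OF ops(1)]]
    clinear_between_arith[OF o1.space operator_on_clinear[OF ops(2)]]
    clinear_between_arith[OF o1.space operator_on_clinear[OF ops(3)]]
    clinear_between_arith[OF o1.space operator_on_clinear[OF ops(4)]]
  have modsq: "modsq z1 z2 x = B1 (N1 x) + B2 (N2 x)" for x
    by (simp add: modsq_def modulus_square_def N1_def N2_def B1_def B2_def)
  have comm: "N1 (N2 x) = N2 (N1 x)" "N1 (B1 x) = B1 (N1 x)" "N1 (B2 x) = B2 (N1 x)"
    "N2 (B1 x) = B1 (N2 x)" "N2 (B2 x) = B2 (N2 x)" if "x \<in> S" for x
    using that commutants[OF that] commute[OF that]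
    by (simp_all add: N1_def N2_def B1_def B2_def scaleC_diff_right scaleC_commute algebra_simps)
  have eqI: "x = y" if "x \<in> S" "y \<in> S" "modsq z1 z2 x = modsq z1 z2 y" for x y
    using inj[of "x - y"] that by simp
  have "koszul_exact S N1 N2"
    unfolding koszul_exact_def
  proof (intro conjI)
    have "x = 0" if "x \<in> S" "koszul0 N1 N2 x = 0" for x
      by (rule inj) (use that in \<open>simp_all add: koszul0_def modsq prod_eq_iff\<close>)
    moreover have "koszul0 N1 N2 0 = 0" by (simp add: koszul0_def prod_eq_iff)
    ultimately show "{x \<in> S. koszul0 N1 N2 x = 0} = {0}" using o1.space_simps(1) by blast
    show "koszul1 N1 N2 ` (S \<times> S) = S"
    proof
      show "koszul1 N1 N2 ` (S \<times> S) \<subseteq> S" by (auto simp: koszul1_def)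
      show "S \<subseteq> koszul1 N1 N2 ` (S \<times> S)"
      proof
        fix y assume "y \<in> S"
        then obtain x where x: "x \<in> S" "y = modsq z1 z2 x" using onto by blast
        then have "y = koszul1 N1 N2 (- B2 x, B1 x)"
          by (simp add: koszul1_def modsq comm)
        then show "y \<in> koszul1 N1 N2 ` (S \<times> S)" using x by (intro image_eqI) auto
      qed
    qed
    show "{p \<in> S \<times> S. koszul1 N1 N2 p = 0} = koszul0 N1 N2 ` S"
    proof
      show "koszul0 N1 N2 ` S \<subseteq> {p \<in> S \<times> S. koszul1 N1 N2 p = 0}"
        by (auto simp: koszul0_def koszul1_def comm)
      show "{p \<in> S \<times> S. koszul1 N1 N2 p = 0} \<subseteq> koszul0 N1 N2 ` S"
      proof
        fix pq assume "pq \<in> {p \<in> S \<times> S. koszul1 N1 N2 p = 0}"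
        then obtain p q where pq: "pq = (p, q)" "p \<in> S" "q \<in> S" "N1 q = N2 p"
          by (cases pq) (auto simp: koszul1_def)
        then have "B1 p + B2 q \<in> S" by simp
        then obtain x where x: "x \<in> S" "modsq z1 z2 x = B1 p + B2 q" using onto by (metis imageE)
        have C: "N1 (modsq z1 z2 x) = modsq z1 z2 (N1 x)" "N2 (modsq z1 z2 x) = modsq z1 z2 (N2 x)"
          using x(1) by (simp_all add: modsq comm)
        have "modsq z1 z2 (N1 x) = modsq z1 z2 p"
          unfolding C[symmetric] x(2) using pq by (simp add: comm modsq)
        then have "N1 x = p" by (rule eqI[rotated 2]) (use pq x in simp_all)
        have "modsq z1 z2 (N2 x) = modsq z1 z2 q"
          unfolding C[symmetric] x(2) using pq by (simp add: comm modsq)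
        then have "N2 x = q" by (rule eqI[rotated 2]) (use pq x in simp_all)
        with \<open>N1 x = p\<close> show "pq \<in> koszul0 N1 N2 ` S"
          using x pq by (auto simp: koszul0_def)
      qed
    qed
  qed
  then show ?thesis by (simp add: N1_def[abs_def] N2_def[abs_def])
qed

end

locale unitary_operator = inverse_operators F U W
  for F :: "'f::complex_hilbert set" and U W +
  assumes isometric: "x \<in> F \<Longrightarrow> y \<in> F \<Longrightarrow> cinner (U x) (U y) = cinner x y"
begin

lemma norm_U [simp]: "x \<in> F \<Longrightarrow> norm (U x) = norm x"
  using isometric[of x x] unfolding cinner_self of_real_eq_iff by simp

lemma norm_W [simp]: "x \<in> F \<Longrightarrow> norm (W x) = norm x"
  using norm_U[of "W x"] by simp

lemma adjoint: "x \<in> F \<Longrightarrow> y \<in> F \<Longrightarrow> cinner (W x) y = cinner x (U y)"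
  using isometric[of "W x" y] by simp

lemma inner_modulus_square:
  assumes "x \<in> F" "y \<in> F"
  shows "inner (modulus_square U W z x) y = inner (U x - z *\<^sub>C x) (U y - z *\<^sub>C y)"
proof -
  have "cinner (modulus_square U W z x) y = cinner (U x - z *\<^sub>C x) (U y - z *\<^sub>C y)"
    unfolding modulus_square_def
    using assms adjoint[of "U x - z *\<^sub>C x" y]
    by (simp only: cinner_diff_left[of "W _"] cinner_scaleC_left[of "cnj z"] cinner_diff_right[of _ "U y"]
      cinner_scaleC_right space_simps T_simps)
  then show ?thesis by (simp add: Re_cinner[symmetric])
qed

lemma norm_angular_derivative_le:
  "x \<in> F \<Longrightarrow> norm (angular_derivative U W z x) \<le> 2 * cmod z * norm x"
  using norm_triangle_ineq4[of "z *\<^sub>C W x" "cnj z *\<^sub>C U x"]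
  by (simp add: angular_derivative_def norm_scaleC mult_ac)

text \<open>
  If \<open>|z| = 1\<close>, the function \<open>|w - z|\<^sup>2\<close> on the unit circle has a double zero at \<open>w = z\<close>, so its
  derivative is still divisible by \<open>w - z\<close>.
\<close>

lemma norm_angular_derivative_unimodular:
  assumes z: "cmod z = 1" and x: "x \<in> F"
  shows "norm (angular_derivative U W z x) \<le> 2 * norm (U x - z *\<^sub>C x)"
proof -
  define a where "a = U x - z *\<^sub>C x"
  have "cnj z * z = 1" using complex_norm_square[of z] z by (simp add: mult.commute)
  moreover have "1 *\<^sub>C x = x" using scaleC_of_real[of 1 x] by simp
  ultimately have "angular_derivative U W z x = - W a - cnj z *\<^sub>C a"
    using x by (simp add: angular_derivative_def a_def scaleC_diff_right scaleC_scaleC)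
  moreover have "a \<in> F" using x by (simp add: a_def)
  ultimately show ?thesis
    using norm_triangle_ineq4[of "- W a" "cnj z *\<^sub>C a"] z by (simp add: norm_scaleC a_def)
qed

text \<open>
  For \<open>z\<close> off the unit circle \<open>U - z\<close> is bounded below, as \<open>U\<close> preserves norms.
\<close>

lemma norm_shift_ge: "x \<in> F \<Longrightarrow> \<bar>1 - cmod z\<bar> * norm x \<le> norm (U x - z *\<^sub>C x)"
  using norm_triangle_ineq3[of "U x" "z *\<^sub>C x"] abs_mult[of "1 - cmod z" "norm x"]
  by (simp add: norm_scaleC left_diff_distrib)

end

text \<open>
  The pair \<open>(A, B)\<close> intertwines \<open>T\<close> with the Jordan block of \<open>U\<close> whose off-diagonal entry is \<open>c U\<close>.
  Applying a function \<open>f\<close> to this block produces the off-diagonal entry \<open>c U f'(U)\<close>.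
\<close>

lemma intertwining_modulus_square:
  assumes "inverse_operators H T R" and "inverse_operators F U W"
    and A: "clinear_between H F A" and B: "clinear_between H F B"
    and AT: "\<And>h. h \<in> H \<Longrightarrow> A (T h) = U (A h) + c *\<^sub>R U (B h)"
    and BT: "\<And>h. h \<in> H \<Longrightarrow> B (T h) = U (B h)"
    and h: "h \<in> H"
  shows "A (modulus_square T R z h) =
      modulus_square U W z (A h) + c *\<^sub>R angular_derivative U W z (B h)"
    and "B (modulus_square T R z h) = modulus_square U W z (B h)"
proof -
  interpret t: inverse_operators H T R by fact
  interpret u: inverse_operators F U W by fact
  note linA [simp] = clinear_between_arith[OF t.space A]
  note linB [simp] = clinear_between_arith[OF t.space B]
  have BR: "B (R h) = W (B h)"
    using BT[of "R h"] h u.R_T[of "B (R h)"] by simp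
  have "A (R h) + c *\<^sub>R B (R h) = W (A h)"
    using AT[of "R h"] h u.R_T[of "A (R h) + c *\<^sub>R B (R h)"] by simp
  then have AR: "A (R h) = W (A h) - c *\<^sub>R W (B h)"
    by (simp add: BR algebra_simps)
  show "B (modulus_square T R z h) = modulus_square U W z (B h)"
    using h by (simp add: t.modulus_square_expand u.modulus_square_expand BR BT)
  show "A (modulus_square T R z h) =
      modulus_square U W z (A h) + c *\<^sub>R angular_derivative U W z (B h)"
    using h by (simp add: t.modulus_square_expand u.modulus_square_expand AR AT
        angular_derivative_def scaleC_diff_right scaleC_add_right scaleC_scaleR_commute
        scaleR_diff_right)
qed

lemma operator_on_continuous_on:
  assumes S: "hilbert_space_on S" and A: "operator_on S A"
  shows "continuous_on S A"
proof -
  obtain b where b: "b > 0" "\<And>x. x \<in> S \<Longrightarrow> norm (A x) \<le> b * norm x"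
    using operator_on_bound[OF A] by blast
  show ?thesis
    using bounded_additive_continuous_on[OF hilbert_space_on_subspace[OF S]
        clinear_between_add[OF S operator_on_clinear[OF A]] b(2)] .
qed

lemma operator_on_null_sequence:
  assumes A: "operator_on S A" and u: "\<And>n. u n \<in> S" "u \<longlonglongrightarrow> 0"
  shows "(\<lambda>n. A (u n)) \<longlonglongrightarrow> 0"
proof -
  obtain b where b: "b > 0" "\<And>x. x \<in> S \<Longrightarrow> norm (A x) \<le> b * norm x"
    using operator_on_bound[OF A] by blast
  show ?thesis
  proof (rule Lim_null_comparison)
    show "\<forall>\<^sub>F n in sequentially. norm (A (u n)) \<le> b * norm (u n)" using b u by simp
    show "(\<lambda>n. b * norm (u n)) \<longlonglongrightarrow> 0"
      using u(2) tendsto_mult_right_zero tendsto_norm_zero by blast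
  qed
qed

lemma scaleR_null_sequence: "u \<longlonglongrightarrow> 0 \<Longrightarrow> (\<lambda>n. r *\<^sub>R u n) \<longlonglongrightarrow> (0 :: 'a::real_normed_vector)"
  using tendsto_scaleR[OF tendsto_const, of u 0 sequentially r] by simp

section \<open>Commuting unitary operators\<close>

locale unitary_pair =
  commuting_inverses F U1 W1 U2 W2 +
  u1: unitary_operator F U1 W1 + u2: unitary_operator F U2 W2
  for F :: "'f::complex_hilbert set" and U1 W1 U2 W2
begin

lemma inner_modsq:
  assumes "x \<in> F" "y \<in> F"
  shows "inner (modsq z1 z2 x) y =
    inner (U1 x - z1 *\<^sub>C x) (U1 y - z1 *\<^sub>C y) + inner (U2 x - z2 *\<^sub>C x) (U2 y - z2 *\<^sub>C y)"
  using assms by (simp add: modsq_def inner_add_left u1.inner_modulus_square u2.inner_modulus_square)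

lemma modsq_symmetric:
  "x \<in> F \<Longrightarrow> y \<in> F \<Longrightarrow> inner (modsq z1 z2 x) y = inner x (modsq z1 z2 y)"
  by (simp add: inner_modsq inner_commute[of x])
     (simp add: inner_commute)

lemma inner_modsq_self:
  "x \<in> F \<Longrightarrow> inner (modsq z1 z2 x) x =
    (norm (U1 x - z1 *\<^sub>C x))\<^sup>2 + (norm (U2 x - z2 *\<^sub>C x))\<^sup>2"
  by (simp add: inner_modsq power2_norm_eq_inner)

text \<open>
  Since \<open>modsq\<close> is symmetric, the norms along a backward orbit are logarithmically convex. If the
  last step contracted by less than \<open>e\<close>, every earlier step would contract at least as much, and
  the norms would outgrow the bound geometrically.
\<close>

lemma backward_orbit_bounded_below:
  assumes u: "\<And>n. u n \<in> F" and step: "\<And>n. modsq z1 z2 (u (Suc n)) = u n"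
    and bound: "\<And>n. norm (u n) \<le> C * (real n + 1) / e ^ n" and e: "e > 0"
  shows "e * norm (u 0) \<le> norm (modsq z1 z2 (u 0))"
proof (rule ccontr)
  define a b where "a n = norm (u n)" and "b = norm (modsq z1 z2 (u 0))" for n
  assume "\<not> ?thesis"
  then have less: "b < e * a 0" by (simp add: a_def b_def)
  have "b \<ge> 0" "a 0 \<ge> 0" by (simp_all add: a_def b_def)
  then have a0: "a 0 > 0" using less e by (smt (verit) mult_nonneg_nonpos)
  have convex0: "(a 0)\<^sup>2 \<le> a 1 * b"
  proof -
    have "(a 0)\<^sup>2 = inner (modsq z1 z2 (u 1)) (u 0)"
      using step[of 0] by (simp add: a_def power2_norm_eq_inner)
    also have "\<dots> = inner (u 1) (modsq z1 z2 (u 0))" by (rule modsq_symmetric[OF u u])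
    also have "\<dots> \<le> a 1 * b" unfolding a_def b_def by (rule norm_cauchy_schwarz)
    finally show ?thesis .
  qed
  have convex: "(a (Suc n))\<^sup>2 \<le> a (Suc (Suc n)) * a n" for n
  proof -
    have "(a (Suc n))\<^sup>2 = inner (modsq z1 z2 (u (Suc (Suc n)))) (u (Suc n))"
      by (simp add: step a_def power2_norm_eq_inner)
    also have "\<dots> = inner (u (Suc (Suc n))) (u n)" using modsq_symmetric[OF u[of "Suc (Suc n)"] u[of "Suc n"], of z1 z2] by (simp add: step)
    also have "\<dots> \<le> a (Suc (Suc n)) * a n" unfolding a_def by (rule norm_cauchy_schwarz)
    finally show ?thesis .
  qed
  have b: "b > 0"
  proof (rule ccontr)
    assume "\<not> b > 0"
    then have "b = 0" using \<open>b \<ge> 0\<close> by simp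
    then show False using convex0 a0 by simp
  qed
  define r where "r = a 0 / b"
  have r: "r > 0" "r * e > 1" using a0 b less by (simp_all add: r_def field_simps)
  have growth: "a n > 0 \<and> r * a n \<le> a (Suc n)" for n
  proof (induction n)
    case 0
    show ?case using convex0 a0 b by (simp add: r_def field_simps power2_eq_square)
  next
    case (Suc n)
    then have pos: "a (Suc n) > 0" using r by (smt (verit) mult_pos_pos)
    have "r * (a (Suc n))\<^sup>2 \<le> r * (a (Suc (Suc n)) * a n)" using convex r by simp
    also have "\<dots> = a (Suc (Suc n)) * (r * a n)" by simp
    also have "\<dots> \<le> a (Suc (Suc n)) * a (Suc n)"
      using Suc by (intro mult_left_mono) (auto simp: a_def)
    finally show ?case using pos by (simp add: power2_eq_square)
  qed
  have geometric: "r ^ n * a 0 \<le> a n" for n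
  proof (induction n)
    case (Suc n)
    have "r ^ Suc n * a 0 = r * (r ^ n * a 0)" by simp
    also have "\<dots> \<le> r * a n" using Suc r by simp
    also have "\<dots> \<le> a (Suc n)" using growth by blast
    finally show ?case .
  qed simp
  have "a 0 \<le> C * ((real n + 1) / (r * e) ^ n)" for n
  proof -
    have "r ^ n * a 0 \<le> C * (real n + 1) / e ^ n"
      using geometric[of n] bound[of n] by (simp add: a_def)
    then show ?thesis using r(1) e by (simp add: field_simps power_mult_distrib)
  qed
  moreover have "(\<lambda>n. C * ((real n + 1) / (r * e) ^ n)) \<longlonglongrightarrow> C * (0 + 0)"
  proof (intro tendsto_intros)
    have "(\<lambda>n. real n / (r * e) ^ n + 1 / (r * e) ^ n) \<longlonglongrightarrow> 0 + 0"
      using lim_n_over_pown[of "r * e"] LIMSEQ_inverse_realpow_zero[OF r(2)] r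
      by (intro tendsto_add) (simp_all add: inverse_eq_divide)
    then show "(\<lambda>n. (real n + 1) / (r * e) ^ n) \<longlonglongrightarrow> 0 + 0" by (simp add: add_divide_distrib)
  qed
  ultimately have "a 0 \<le> 0" by (intro LIMSEQ_le_const[where X = "\<lambda>n. C * ((real n + 1) / (r * e) ^ n)"]) auto
  then show False using a0 by simp
qed

text \<open>
  A vector starting a backward orbit of \<open>modsq\<close> that grows no faster than \<open>e\<^sup>-\<^sup>n\<close>, up to a linear
  factor, is one on which \<open>modsq\<close> acts as if it were bounded below by \<open>e\<close>: this set replaces the
  spectral subspace of \<open>modsq\<close> over \<open>[e, \<infinity>)\<close>. The linear factor accommodates the off-diagonal
  entries of powers of a Jordan block.
\<close>

definition backward_orbits :: "complex \<Rightarrow> complex \<Rightarrow> real \<Rightarrow> 'f set" where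
  "backward_orbits z1 z2 e = {u 0 | u. (\<forall>n. u n \<in> F) \<and> (\<forall>n. modsq z1 z2 (u (Suc n)) = u n) \<and>
     (\<exists>C. \<forall>n. norm (u n) \<le> C * (real n + 1) / e ^ n)}"

lemma backward_orbitsI:
  assumes "\<And>n. u n \<in> F" "\<And>n. modsq z1 z2 (u (Suc n)) = u n"
    "\<And>n. norm (u n) \<le> C * (real n + 1) / e ^ n"
  shows "u 0 \<in> backward_orbits z1 z2 e"
  using assms unfolding backward_orbits_def by blast

lemma backward_orbits_add:
  assumes "x \<in> backward_orbits z1 z2 e" "y \<in> backward_orbits z1 z2 e"
  shows "x + y \<in> backward_orbits z1 z2 e"
proof -
  obtain u C where u: "x = u 0" "\<And>n. u n \<in> F" "\<And>n. modsq z1 z2 (u (Suc n)) = u n"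
    "\<And>n. norm (u n) \<le> C * (real n + 1) / e ^ n"
    using assms(1) unfolding backward_orbits_def by blast
  obtain v D where v: "y = v 0" "\<And>n. v n \<in> F" "\<And>n. modsq z1 z2 (v (Suc n)) = v n"
    "\<And>n. norm (v n) \<le> D * (real n + 1) / e ^ n"
    using assms(2) unfolding backward_orbits_def by blast
  have "norm (u n + v n) \<le> (C + D) * (real n + 1) / e ^ n" for n
    using norm_triangle_ineq[of "u n" "v n"] u(4)[of n] v(4)[of n]
    by (simp add: distrib_right add_divide_distrib)
  then show ?thesis
    unfolding u(1) v(1) using u v by (intro backward_orbitsI[of "\<lambda>n. u n + v n"]) simp_all
qed

lemma backward_orbits_image:
  assumes A: "operator_on F A" "\<And>x. x \<in> F \<Longrightarrow> A (U1 x) = U1 (A x)"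
    "\<And>x. x \<in> F \<Longrightarrow> A (U2 x) = U2 (A x)"
    and x: "x \<in> backward_orbits z1 z2 e" and e: "e > 0"
  shows "A x \<in> backward_orbits z1 z2 e"
proof -
  note linA [simp] = clinear_between_arith[OF o1.space operator_on_clinear[OF A(1)]]
  obtain u C where u: "x = u 0" "\<And>n. u n \<in> F" "\<And>n. modsq z1 z2 (u (Suc n)) = u n"
    "\<And>n. norm (u n) \<le> C * (real n + 1) / e ^ n"
    using x unfolding backward_orbits_def by blast
  obtain b where b: "b > 0" "\<And>x. x \<in> F \<Longrightarrow> norm (A x) \<le> b * norm x"
    using operator_on_bound[OF A(1)] by blast
  show ?thesis
    unfolding u(1)
  proof (rule backward_orbitsI[of "\<lambda>n. A (u n)"])
    show "A (u n) \<in> F" for n using u by simp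
    show "modsq z1 z2 (A (u (Suc n))) = A (u n)" for n
      using modsq_commute[OF operator_on_clinear[OF A(1)] A(2,3) u(2)[of "Suc n"], of z1 z2] u(3)
      by simp
    show "norm (A (u n)) \<le> (b * C) * (real n + 1) / e ^ n" for n
    proof -
      have "norm (A (u n)) \<le> b * (C * (real n + 1) / e ^ n)"
        using b(2)[OF u(2)] mult_left_mono[OF u(4)[of n], of b] b(1) by (smt (verit))
      then show ?thesis by (simp add: mult.assoc)
    qed
  qed
qed

text \<open>
  The inverses are the adjoints, so invariance under them makes the orthogonal complement invariant
  under the unitaries as well.
\<close>

definition reducing :: "'f set \<Rightarrow> bool" where
  "reducing E \<longleftrightarrow> hilbert_space_on E \<and> E \<subseteq> F \<and>
     (\<forall>x\<in>E. U1 x \<in> E \<and> W1 x \<in> E \<and> U2 x \<in> E \<and> W2 x \<in> E)"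

lemma reducing_closure_backward_orbits:
  assumes e: "e > 0"
  shows "reducing (closure (backward_orbits z1 z2 e))"
proof -
  define G where "G = backward_orbits z1 z2 e"
  have G_F: "G \<subseteq> F" unfolding G_def backward_orbits_def by blast
  then have cG_F: "closure G \<subseteq> F" by (simp add: closure_minimal hilbert_space_on_closed[OF o1.space])
  have image: "A x \<in> closure G"
    if A: "operator_on F A" "\<And>x. x \<in> F \<Longrightarrow> A (U1 x) = U1 (A x)"
      "\<And>x. x \<in> F \<Longrightarrow> A (U2 x) = U2 (A x)" and x: "x \<in> closure G" for A x
  proof -
    have "A ` closure G \<subseteq> closure G"
    proof (rule image_closure_subset)
      show "continuous_on (closure G) A"
        by (rule continuous_on_subset[OF operator_on_continuous_on[OF o1.space A(1)] cG_F])
      show "A ` G \<subseteq> closure G"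
        using backward_orbits_image[OF A _ e] closure_subset unfolding G_def by blast
    qed simp
    then show ?thesis using x by blast
  qed
  have "hilbert_space_on (closure G)"
    unfolding hilbert_space_on_def
  proof (intro conjI ballI allI)
    have "0 \<in> G" unfolding G_def
      using backward_orbitsI[of "\<lambda>n. 0" z1 z2 0 e] by simp
    then show "0 \<in> closure G" using closure_subset by blast
    show "x + y \<in> closure G" if xy: "x \<in> closure G" "y \<in> closure G" for x y
    proof -
      obtain p q where "\<And>n. p n \<in> G" "p \<longlonglongrightarrow> x" "\<And>n. q n \<in> G" "q \<longlonglongrightarrow> y"
        using xy unfolding closure_sequential by blast
      then have "\<And>n. p n + q n \<in> G" "(\<lambda>n. p n + q n) \<longlonglongrightarrow> x + y"
        unfolding G_def by (auto intro: backward_orbits_add tendsto_add)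
      then show ?thesis
        unfolding closure_sequential by (intro exI[of _ "\<lambda>n. p n + q n"] conjI allI)
    qed
    show "a *\<^sub>C x \<in> closure G" if "x \<in> closure G" for a x
      by (rule image[OF operator_on_scaleC[OF o1.space operator_on_ident]]) (use that in simp_all)
  qed simp
  moreover have "U1 x \<in> closure G" "U2 x \<in> closure G" "W1 x \<in> closure G" "W2 x \<in> closure G"
    if "x \<in> closure G" for x
    using image[OF o1.T_op _ _ that] image[OF o2.T_op _ _ that]
      image[OF o1.R_op _ _ that] image[OF o2.R_op _ _ that]
    by (simp_all add: commute commutants)
  ultimately show ?thesis using cG_F by (simp add: reducing_def G_def)
qed

lemma closure_backward_orbits_bounded_below:
  assumes e: "e > 0" and x: "x \<in> closure (backward_orbits z1 z2 e)"
  shows "e * norm x \<le> norm (modsq z1 z2 x)"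
proof -
  have "closure (backward_orbits z1 z2 e) \<subseteq> {x \<in> F. e * norm x \<le> norm (modsq z1 z2 x)}"
  proof (rule closure_minimal)
    show "backward_orbits z1 z2 e \<subseteq> {x \<in> F. e * norm x \<le> norm (modsq z1 z2 x)}"
      using backward_orbit_bounded_below[OF _ _ _ e] unfolding backward_orbits_def by blast
    show "closed {x \<in> F. e * norm x \<le> norm (modsq z1 z2 x)}"
      by (intro continuous_on_closed_Collect_le continuous_intros
          operator_on_continuous_on[OF o1.space modsq_op] hilbert_space_on_closed[OF o1.space])
  qed
  then show ?thesis using x by blast
qed

end

section \<open>Lifts to Jordan pairs\<close>

text \<open>
  The three components of an isometric lift to a Jordan pair. The lifting condition becomes the six
  intertwining relations, and the isometry becomes \<open>norm_components\<close>.
\<close>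

locale jordan_lift =
  t: commuting_inverses H T1 R1 T2 R2 + u: unitary_pair F U1 W1 U2 W2
  for H :: "'h::complex_hilbert set" and T1 R1 T2 R2
    and F :: "'f::complex_hilbert set" and U1 W1 U2 W2 +
  fixes X Y Z :: "'h \<Rightarrow> 'f" and c d :: real
  assumes X_lin: "clinear_between H F X" and Y_lin: "clinear_between H F Y"
    and Z_lin: "clinear_between H F Z"
    and norm_components:
      "h \<in> H \<Longrightarrow> (norm h)\<^sup>2 = (norm (X h))\<^sup>2 + (norm (Y h))\<^sup>2 + (norm (Z h))\<^sup>2"
    and X_T1: "h \<in> H \<Longrightarrow> X (T1 h) = U1 (X h) + c *\<^sub>R U1 (Y h)"
    and X_T2: "h \<in> H \<Longrightarrow> X (T2 h) = U2 (X h) + d *\<^sub>R U2 (Z h)"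
    and Y_T1: "h \<in> H \<Longrightarrow> Y (T1 h) = U1 (Y h)" and Y_T2: "h \<in> H \<Longrightarrow> Y (T2 h) = U2 (Y h)"
    and Z_T1: "h \<in> H \<Longrightarrow> Z (T1 h) = U1 (Z h)" and Z_T2: "h \<in> H \<Longrightarrow> Z (T2 h) = U2 (Z h)"
begin

lemmas X_simps [simp] = clinear_between_arith[OF t.o1.space X_lin]
lemmas Y_simps [simp] = clinear_between_arith[OF t.o1.space Y_lin]
lemmas Z_simps [simp] = clinear_between_arith[OF t.o1.space Z_lin]

lemma norm_X_le: "h \<in> H \<Longrightarrow> norm (X h) \<le> norm h"
  and norm_Y_le: "h \<in> H \<Longrightarrow> norm (Y h) \<le> norm h"
  and norm_Z_le: "h \<in> H \<Longrightarrow> norm (Z h) \<le> norm h"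
proof -
  assume h: "h \<in> H"
  show "norm (X h) \<le> norm h" "norm (Y h) \<le> norm h" "norm (Z h) \<le> norm h"
    by (rule power2_le_imp_le; simp add: norm_components[OF h])+
qed

text \<open>
  The first row of \<open>modsq\<close> of the Jordan pair beyond the diagonal, applied to the lift of \<open>h\<close>.
\<close>

definition coupling :: "complex \<Rightarrow> complex \<Rightarrow> 'h \<Rightarrow> 'f" where
  "coupling z1 z2 h =
     c *\<^sub>R angular_derivative U1 W1 z1 (Y h) + d *\<^sub>R angular_derivative U2 W2 z2 (Z h)"

lemma Y_modsq: "h \<in> H \<Longrightarrow> Y (t.modsq z1 z2 h) = u.modsq z1 z2 (Y h)"
  and Z_modsq: "h \<in> H \<Longrightarrow> Z (t.modsq z1 z2 h) = u.modsq z1 z2 (Z h)"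
  and X_modsq: "h \<in> H \<Longrightarrow> X (t.modsq z1 z2 h) = u.modsq z1 z2 (X h) + coupling z1 z2 h"
proof -
  note ops1 = t.o1.inverse_operators_axioms u.o1.inverse_operators_axioms
  note ops2 = t.o2.inverse_operators_axioms u.o2.inverse_operators_axioms
  assume h: "h \<in> H"
  have in_H: "modulus_square T1 R1 z1 h \<in> H" "modulus_square T2 R2 z2 h \<in> H"
    using h operator_on_clinear[OF t.o1.modulus_square_op] operator_on_clinear[OF t.o2.modulus_square_op]
    by (simp_all add: clinear_between_def)
  show "Y (t.modsq z1 z2 h) = u.modsq z1 z2 (Y h)"
    using h in_H intertwining_modulus_square(2)[OF ops1 X_lin Y_lin X_T1 Y_T1 h, of z1]
      intertwining_modulus_square(1)[OF ops2 Y_lin Y_lin, of 0 h z2] Y_T2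
    by (simp add: t.modsq_def u.modsq_def)
  show "Z (t.modsq z1 z2 h) = u.modsq z1 z2 (Z h)"
    using h in_H intertwining_modulus_square(2)[OF ops2 X_lin Z_lin X_T2 Z_T2 h, of z2]
      intertwining_modulus_square(1)[OF ops1 Z_lin Z_lin, of 0 h z1] Z_T1
    by (simp add: t.modsq_def u.modsq_def)
  show "X (t.modsq z1 z2 h) = u.modsq z1 z2 (X h) + coupling z1 z2 h"
    using h in_H intertwining_modulus_square(1)[OF ops1 X_lin Y_lin X_T1 Y_T1 h, of z1]
      intertwining_modulus_square(1)[OF ops2 X_lin Z_lin X_T2 Z_T2 h, of z2]
    by (simp add: t.modsq_def u.modsq_def coupling_def)
qed

lemma coupling_in: "h \<in> H \<Longrightarrow> coupling z1 z2 h \<in> F"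
  using operator_on_clinear[OF u.o1.angular_derivative_op] operator_on_clinear[OF u.o2.angular_derivative_op]
  by (simp add: coupling_def clinear_between_def)

lemma norm_coupling_le:
  assumes h: "h \<in> H" and C: "C = 2 * \<bar>c\<bar> * cmod z1 + 2 * \<bar>d\<bar> * cmod z2"
  shows "norm (coupling z1 z2 h) \<le> C * norm (Y h) + C * norm (Z h)"
proof -
  have "norm (coupling z1 z2 h) \<le> \<bar>c\<bar> * norm (angular_derivative U1 W1 z1 (Y h))
      + \<bar>d\<bar> * norm (angular_derivative U2 W2 z2 (Z h))"
    unfolding coupling_def by (rule norm_triangle_le) simp
  also have "\<dots> \<le> \<bar>c\<bar> * (2 * cmod z1 * norm (Y h)) + \<bar>d\<bar> * (2 * cmod z2 * norm (Z h))"
    using h by (intro add_mono mult_left_mono u.u1.norm_angular_derivative_le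
        u.u2.norm_angular_derivative_le) simp_all
  also have "\<dots> \<le> C * norm (Y h) + C * norm (Z h)"
    by (simp add: C distrib_right)
  finally show ?thesis .
qed

text \<open>
  Through the lift, \<open>modsq + \<tau>\<close> on \<open>H\<close> is the restriction of an upper triangular operator with
  coercive diagonal. Scaling the components \<open>Y\<close> and \<open>Z\<close> by a large factor \<open>K\<close> makes the off-diagonal
  entries small compared with the diagonal, so the operator is coercive for the renormed space.
\<close>

lemma shifted_modsq_bijective:
  assumes e: "e > 0"
    and coercive: "\<And>x. x \<in> F \<Longrightarrow> e * (norm x)\<^sup>2 \<le> inner (u.modsq z1 z2 x) x + \<tau> * (norm x)\<^sup>2"
  shows "(\<lambda>h. t.modsq z1 z2 h + \<tau> *\<^sub>R h) ` H = H"
    and "h \<in> H \<Longrightarrow> t.modsq z1 z2 h + \<tau> *\<^sub>R h = 0 \<Longrightarrow> h = 0"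
proof -
  define A where "A h = t.modsq z1 z2 h + \<tau> *\<^sub>R h" for h
  define S where "S x = u.modsq z1 z2 x + \<tau> *\<^sub>R x" for x
  have S_coercive: "e * (norm x)\<^sup>2 \<le> inner (S x) x" if "x \<in> F" for x
    using coercive[OF that] by (simp add: S_def inner_add_left power2_norm_eq_inner)
  have XA: "X (A h) = S (X h) + coupling z1 z2 h" and YA: "Y (A h) = S (Y h)"
    and ZA: "Z (A h) = S (Z h)" if "h \<in> H" for h
    using that by (simp_all add: A_def S_def X_modsq Y_modsq Z_modsq)
  have S0: "x = 0" if "x \<in> F" "S x = 0" for x
    using S_coercive[OF that(1)] e that(2) by (simp add: mult_le_0_iff)
  show "h = 0" if h: "h \<in> H" and "t.modsq z1 z2 h + \<tau> *\<^sub>R h = 0"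
  proof -
    have "A h = 0" using that by (simp add: A_def)
    then have "Y h = 0" "Z h = 0" using S0[of "Y h"] S0[of "Z h"] YA[OF h] ZA[OF h] h by simp_all
    moreover from this have "coupling z1 z2 h = 0"
      by (simp add: coupling_def angular_derivative_def)
    then have "X h = 0" using S0[of "X h"] XA[OF h] h \<open>A h = 0\<close> by simp
    ultimately show "h = 0" using norm_components[OF h] by simp
  qed
  define C where "C = 2 * \<bar>c\<bar> * cmod z1 + 2 * \<bar>d\<bar> * cmod z2"
  have C: "C \<ge> 0" by (simp add: C_def)
  \<comment> \<open>Half of the coercivity constant \<open>e\<close> absorbs the coupling as soon as \<open>e K \<ge> 2 C\<close>; the summand
    \<open>1\<close> makes the new norm dominate the old one.\<close>
  define K where "K = 1 + 2 * C / e"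
  have K: "K \<ge> 1" using C e by (simp add: K_def)
  have KC: "4 * C\<^sup>2 / e \<le> e * K\<^sup>2"
  proof -
    have "(2 * C / e)\<^sup>2 \<le> K\<^sup>2" using C e by (intro power_mono) (simp_all add: K_def)
    then have "e * (2 * C / e)\<^sup>2 \<le> e * K\<^sup>2" using e by simp
    then show ?thesis using e by (simp add: power2_eq_square)
  qed
  define w where "w h = (X h, K *\<^sub>R Y h, K *\<^sub>R Z h)" for h
  have norm_w: "(norm (w h))\<^sup>2 = (norm (X h))\<^sup>2 + K\<^sup>2 * (norm (Y h))\<^sup>2 + K\<^sup>2 * (norm (Z h))\<^sup>2" for h
    by (simp add: w_def norm_Pair power_mult_distrib)
  obtain B0 where B0: "B0 > 0" "\<And>h. h \<in> H \<Longrightarrow> norm (t.modsq z1 z2 h) \<le> B0 * norm h"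
    using operator_on_bound[OF t.modsq_op] by blast
  show "(\<lambda>h. t.modsq z1 z2 h + \<tau> *\<^sub>R h) ` H = H"
    unfolding A_def[symmetric]
  proof (rule surjective_if_coercive[where W = w and e = "e / 2" and m = 1 and M = K and B = "B0 + \<bar>\<tau>\<bar>"])
    show "subspace H" "closed H"
      by (rule hilbert_space_on_subspace[OF t.o1.space] hilbert_space_on_closed[OF t.o1.space])+
    show "A h \<in> H" if "h \<in> H" for h using that by (simp add: A_def)
    show "A (x + y) = A x + A y" if "x \<in> H" "y \<in> H" for x y
      using that by (simp add: A_def scaleR_add_right)
    show "A (r *\<^sub>R x) = r *\<^sub>R A x" if "x \<in> H" for r x
      using that by (simp add: A_def scaleR_add_right)
    show "norm (A x) \<le> (B0 + \<bar>\<tau>\<bar>) * norm x" if "x \<in> H" for x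
      using norm_triangle_ineq[of "t.modsq z1 z2 x" "\<tau> *\<^sub>R x"] B0(2)[OF that]
      by (simp add: A_def distrib_right)
    show "w (x - y) = w x - w y" if "x \<in> H" "y \<in> H" for x y
      using that by (simp add: w_def scaleR_diff_right)
    show "w (r *\<^sub>R x) = r *\<^sub>R w x" if "x \<in> H" for r x
      using that by (simp add: w_def)
    have K2: "K\<^sup>2 \<ge> 1" using K by simp
    show "norm x \<le> 1 * norm (w x)" if "x \<in> H" for x
    proof -
      have "(norm x)\<^sup>2 \<le> (norm (w x))\<^sup>2"
        using K2 mult_right_mono[OF K2, of "(norm (Y x))\<^sup>2"] mult_right_mono[OF K2, of "(norm (Z x))\<^sup>2"]
        by (simp add: norm_w norm_components[OF that])
      then show ?thesis using power2_le_imp_le[of "norm x" "norm (w x)"] by simp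
    qed
    show "norm (w x) \<le> K * norm x" if "x \<in> H" for x
    proof -
      have "(norm (w x))\<^sup>2 \<le> (K * norm x)\<^sup>2"
        using mult_right_mono[OF K2, of "(norm (X x))\<^sup>2"]
        by (simp add: norm_w norm_components[OF that] power_mult_distrib distrib_left)
      then show ?thesis by (rule power2_le_imp_le) (use K in simp)
    qed
    show "e / 2 * (norm (w h))\<^sup>2 \<le> inner (w (A h)) (w h)" if h: "h \<in> H" for h
    proof -
      define x y z where "x = norm (X h)" and "y = norm (Y h)" and "z = norm (Z h)"
      have young: "C * v * x \<le> e / 4 * x\<^sup>2 + e / 4 * (K\<^sup>2 * v\<^sup>2) + e / 4 * (K\<^sup>2 * v\<^sup>2)" for v
      proof -
        have "0 \<le> (e * x - 2 * C * v)\<^sup>2" by simp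
        then have "4 * e * (C * v * x) \<le> e * e * x\<^sup>2 + 4 * C\<^sup>2 * v\<^sup>2"
          by (simp add: power2_eq_square algebra_simps)
        moreover have "4 * C\<^sup>2 * v\<^sup>2 \<le> e * (e * K\<^sup>2 * v\<^sup>2)"
        proof -
          have "4 * C\<^sup>2 \<le> e * (e * K\<^sup>2)" using KC e by (simp add: field_simps)
          from mult_right_mono[OF this, of "v\<^sup>2"] show ?thesis by (simp add: mult.assoc)
        qed
        moreover have "0 \<le> e * (e * K\<^sup>2 * v\<^sup>2)" using e by simp
        ultimately have "e * (4 * (C * v * x)) \<le> e * (e * x\<^sup>2 + 2 * (e * (K\<^sup>2 * v\<^sup>2)))"
          by (simp add: algebra_simps)
        then have "4 * (C * v * x) \<le> e * x\<^sup>2 + 2 * (e * (K\<^sup>2 * v\<^sup>2))" using e by (simp only: mult_le_cancel_left_pos)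
        then show ?thesis by simp
      qed
      have "\<bar>inner (coupling z1 z2 h) (X h)\<bar> \<le> norm (coupling z1 z2 h) * norm (X h)"
        by (rule Cauchy_Schwarz_ineq2)
      also have "\<dots> \<le> (C * y + C * z) * x"
        unfolding x_def y_def z_def by (intro mult_right_mono norm_coupling_le[OF h C_def]) simp
      finally have "- (C * y * x + C * z * x) \<le> inner (coupling z1 z2 h) (X h)"
        by (simp add: distrib_right)
      moreover have "inner (w (A h)) (w h) = inner (S (X h)) (X h) + inner (coupling z1 z2 h) (X h)
          + K\<^sup>2 * inner (S (Y h)) (Y h) + K\<^sup>2 * inner (S (Z h)) (Z h)"
        using h by (simp add: w_def XA YA ZA inner_add_left power2_eq_square)
      moreover have "e * x\<^sup>2 \<le> inner (S (X h)) (X h)"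
        "K\<^sup>2 * (e * y\<^sup>2) \<le> K\<^sup>2 * inner (S (Y h)) (Y h)"
        "K\<^sup>2 * (e * z\<^sup>2) \<le> K\<^sup>2 * inner (S (Z h)) (Z h)"
        unfolding x_def y_def z_def
        using h by (auto intro!: mult_left_mono S_coercive)
      moreover have "e / 2 * (norm (w h))\<^sup>2 = e / 2 * x\<^sup>2 + e / 2 * (K\<^sup>2 * y\<^sup>2) + e / 2 * (K\<^sup>2 * z\<^sup>2)"
        by (simp add: norm_w x_def y_def z_def algebra_simps)
      moreover have "K\<^sup>2 * (e * y\<^sup>2) = e * (K\<^sup>2 * y\<^sup>2)" "K\<^sup>2 * (e * z\<^sup>2) = e * (K\<^sup>2 * z\<^sup>2)" by simp_all
      ultimately show ?thesis using young[of y] young[of z] by linarith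
    qed
    show "0 < e / 2" "0 < K" "0 < B0 + \<bar>\<tau>\<bar>" using e K B0 by simp_all
  qed simp
qed

lemma koszul_exact_if_jointly_bounded_below:
  assumes "jointly_bounded_below F (\<lambda>x. U1 x - z1 *\<^sub>C x) (\<lambda>x. U2 x - z2 *\<^sub>C x)"
  shows "koszul_exact H (\<lambda>x. T1 x - z1 *\<^sub>C x) (\<lambda>x. T2 x - z2 *\<^sub>C x)"
proof -
  obtain e where e: "e > 0" "\<And>x. x \<in> F \<Longrightarrow>
      e * (norm x)\<^sup>2 \<le> (norm (U1 x - z1 *\<^sub>C x))\<^sup>2 + (norm (U2 x - z2 *\<^sub>C x))\<^sup>2"
    using assms unfolding jointly_bounded_below_def by blast
  have "e * (norm x)\<^sup>2 \<le> inner (u.modsq z1 z2 x) x + 0 * (norm x)\<^sup>2" if "x \<in> F" for x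
    using e(2)[OF that] that by (simp add: u.inner_modsq_self)
  from shifted_modsq_bijective[OF e(1) this]
  show ?thesis by (intro t.koszul_exact_if_modsq_bijective) simp_all
qed

end

section \<open>Localizing the lift on a reducing subspace\<close>

context jordan_lift
begin

text \<open>
  On the unit circle \<open>modsq\<close> vanishes to second order, so it controls second differences of \<open>T\<close>
  only. For unit vectors \<open>h\<close> with \<open>modsq h\<close> tending to \<open>0\<close>, the unitaries act on all three components
  almost as the scalars \<open>z1\<close> and \<open>z2\<close>. Then \<open>(T - z) h\<close> need not be small, because of the off-diagonal
  entry of the Jordan block, but every product of two of the shifted operators sends \<open>h\<close> to almost
  \<open>0\<close>. Using that the shifted pair is jointly bounded below twice contradicts \<open>\<parallel>h\<parallel> = 1\<close>.
\<close>

lemma modsq_bounded_below: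
  assumes z: "cmod z1 = 1" "cmod z2 = 1"
    and below: "jointly_bounded_below H (\<lambda>x. T1 x - z1 *\<^sub>C x) (\<lambda>x. T2 x - z2 *\<^sub>C x)"
  shows "\<exists>e>0. \<forall>h\<in>H. e * norm h \<le> norm (t.modsq z1 z2 h)"
proof (rule ccontr)
  assume neg: "\<not> ?thesis"
  define M1 M2 where "M1 h = T1 h - z1 *\<^sub>C h" and "M2 h = T2 h - z2 *\<^sub>C h" for h
  define N1 N2 where "N1 x = U1 x - z1 *\<^sub>C x" and "N2 x = U2 x - z2 *\<^sub>C x" for x
  have M_ops: "operator_on H M1" "operator_on H M2" and N_ops: "operator_on F N1" "operator_on F N2"
    using t.o1.shift_op t.o2.shift_op u.o1.shift_op u.o2.shift_op
    by (simp_all add: M1_def[abs_def] M2_def[abs_def] N1_def[abs_def] N2_def[abs_def])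
  note [simp] = clinear_between_arith[OF t.o1.space operator_on_clinear[OF M_ops(1)]]
    clinear_between_arith[OF t.o1.space operator_on_clinear[OF M_ops(2)]]
    clinear_between_arith[OF u.o1.space operator_on_clinear[OF N_ops(1)]]
    clinear_between_arith[OF u.o1.space operator_on_clinear[OF N_ops(2)]]
  have X_M: "X (M1 h) = N1 (X h) + c *\<^sub>R U1 (Y h)" "X (M2 h) = N2 (X h) + d *\<^sub>R U2 (Z h)"
    and Y_M: "Y (M1 h) = N1 (Y h)" "Y (M2 h) = N2 (Y h)"
    and Z_M: "Z (M1 h) = N1 (Z h)" "Z (M2 h) = N2 (Z h)" if "h \<in> H" for h
    using that
    by (simp_all add: M1_def M2_def N1_def N2_def X_T1 X_T2 Y_T1 Y_T2 Z_T1 Z_T2 algebra_simps)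
  have N_U: "N1 (U1 x) = U1 (N1 x)" "N1 (U2 x) = U2 (N1 x)" "N2 (U1 x) = U1 (N2 x)"
    "N2 (U2 x) = U2 (N2 x)" if "x \<in> F" for x
    using that by (simp_all add: N1_def N2_def u.commute)
  have "\<exists>h\<in>H. norm h = 1 \<and> norm (t.modsq z1 z2 h) \<le> 1 / real (Suc n)" for n
  proof -
    have "1 / real (Suc n) > 0" by simp
    then obtain h where h: "h \<in> H" "norm (t.modsq z1 z2 h) < 1 / real (Suc n) * norm h"
      using neg not_le by blast
    then have pos: "norm h > 0" by (metis mult_zero_right norm_not_less_zero zero_less_norm_iff norm_zero)
    have "norm (t.modsq z1 z2 ((1 / norm h) *\<^sub>R h)) = norm (t.modsq z1 z2 h) / norm h"
      using h by simp
    also have "\<dots> \<le> 1 / real (Suc n)" using h(2) pos by (simp add: pos_divide_le_eq)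
    finally show ?thesis using h(1) pos by (intro bexI[of _ "(1 / norm h) *\<^sub>R h"]) simp_all
  qed
  then obtain h where hH [simp]: "\<And>n. h n \<in> H" and h1: "\<And>n. norm (h n) = 1"
    and hS: "\<And>n. norm (t.modsq z1 z2 (h n)) \<le> 1 / real (Suc n)" by metis
  have S_null: "(\<lambda>n. t.modsq z1 z2 (h n)) \<longlonglongrightarrow> 0"
    by (rule Lim_null_comparison[OF _ LIMSEQ_Suc[OF lim_1_over_n]]) (use hS in simp)
  have N_null: "(\<lambda>n. N1 (v n)) \<longlonglongrightarrow> 0" "(\<lambda>n. N2 (v n)) \<longlonglongrightarrow> 0"
    if v: "\<And>n. v n \<in> F" "\<And>n. norm (v n) \<le> 1" "(\<lambda>n. u.modsq z1 z2 (v n)) \<longlonglongrightarrow> 0" for v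
  proof -
    have le: "(norm (N1 (v n)))\<^sup>2 + (norm (N2 (v n)))\<^sup>2 \<le> norm (u.modsq z1 z2 (v n))" for n
    proof -
      have "(norm (N1 (v n)))\<^sup>2 + (norm (N2 (v n)))\<^sup>2 = inner (u.modsq z1 z2 (v n)) (v n)"
        using u.inner_modsq_self[OF v(1)] by (simp add: N1_def N2_def)
      also have "\<dots> \<le> norm (u.modsq z1 z2 (v n)) * norm (v n)" by (rule norm_cauchy_schwarz)
      also have "\<dots> \<le> norm (u.modsq z1 z2 (v n)) * 1" using v(2) by (intro mult_left_mono) auto
      finally show ?thesis by simp
    qed
    have "(\<lambda>n. (norm (N1 (v n)))\<^sup>2) \<longlonglongrightarrow> 0"
    proof (rule Lim_null_comparison[OF _ tendsto_norm_zero[OF v(3)]], intro always_eventually allI)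
      show "norm ((norm (N1 (v n)))\<^sup>2) \<le> norm (u.modsq z1 z2 (v n))" for n
        using le[of n] by (smt (verit) real_norm_def zero_le_power2)
    qed
    then show "(\<lambda>n. N1 (v n)) \<longlonglongrightarrow> 0" by (simp add: tendsto_norm_zero_iff)
    have "(\<lambda>n. (norm (N2 (v n)))\<^sup>2) \<longlonglongrightarrow> 0"
    proof (rule Lim_null_comparison[OF _ tendsto_norm_zero[OF v(3)]], intro always_eventually allI)
      show "norm ((norm (N2 (v n)))\<^sup>2) \<le> norm (u.modsq z1 z2 (v n))" for n
        using le[of n] by (smt (verit) real_norm_def zero_le_power2)
    qed
    then show "(\<lambda>n. N2 (v n)) \<longlonglongrightarrow> 0" by (simp add: tendsto_norm_zero_iff)
  qed
  have component_null: "(\<lambda>n. X (g n)) \<longlonglongrightarrow> 0" "(\<lambda>n. Y (g n)) \<longlonglongrightarrow> 0" "(\<lambda>n. Z (g n)) \<longlonglongrightarrow> 0"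
    if "\<And>n. g n \<in> H" "g \<longlonglongrightarrow> 0" for g
    by (rule Lim_null_comparison[OF _ tendsto_norm_zero[OF that(2)]];
        simp add: that norm_X_le norm_Y_le norm_Z_le)+
  have null_if_components: "g \<longlonglongrightarrow> 0"
    if g: "\<And>n. g n \<in> H" "(\<lambda>n. X (g n)) \<longlonglongrightarrow> 0" "(\<lambda>n. Y (g n)) \<longlonglongrightarrow> 0" "(\<lambda>n. Z (g n)) \<longlonglongrightarrow> 0" for g
  proof -
    have "(\<lambda>n. (norm (X (g n)))\<^sup>2 + (norm (Y (g n)))\<^sup>2 + (norm (Z (g n)))\<^sup>2) \<longlonglongrightarrow> 0\<^sup>2 + 0\<^sup>2 + 0\<^sup>2"
      using g by (intro tendsto_intros tendsto_norm_zero)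
    then have "(\<lambda>n. (norm (g n))\<^sup>2) \<longlonglongrightarrow> 0" using norm_components[OF g(1)] by simp
    then show ?thesis by (simp add: tendsto_norm_zero_iff)
  qed
  have null_if_M: "g \<longlonglongrightarrow> 0"
    if g: "\<And>n. g n \<in> H" "(\<lambda>n. M1 (g n)) \<longlonglongrightarrow> 0" "(\<lambda>n. M2 (g n)) \<longlonglongrightarrow> 0" for g
  proof -
    obtain e where e: "e > 0" "\<And>x. x \<in> H \<Longrightarrow> e * (norm x)\<^sup>2 \<le> (norm (M1 x))\<^sup>2 + (norm (M2 x))\<^sup>2"
      using below unfolding jointly_bounded_below_def M1_def M2_def by blast
    have "(\<lambda>n. (1 / e) * ((norm (M1 (g n)))\<^sup>2 + (norm (M2 (g n)))\<^sup>2)) \<longlonglongrightarrow> (1 / e) * (0\<^sup>2 + 0\<^sup>2)"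
      using g by (intro tendsto_intros tendsto_norm_zero)
    then have lim: "(\<lambda>n. (1 / e) * ((norm (M1 (g n)))\<^sup>2 + (norm (M2 (g n)))\<^sup>2)) \<longlonglongrightarrow> 0" by simp
    have "(\<lambda>n. (norm (g n))\<^sup>2) \<longlonglongrightarrow> 0"
    proof (rule Lim_null_comparison[OF _ lim], intro always_eventually allI)
      show "norm ((norm (g n))\<^sup>2) \<le> (1 / e) * ((norm (M1 (g n)))\<^sup>2 + (norm (M2 (g n)))\<^sup>2)" for n
        using e(2)[OF g(1)[of n]] e(1) by (simp add: pos_le_divide_eq mult.commute)
    qed
    then show ?thesis by (simp add: tendsto_norm_zero_iff)
  qed
  have Sc: "t.modsq z1 z2 (h n) \<in> H" for n by simp
  have bounds: "norm (X (h n)) \<le> 1" "norm (Y (h n)) \<le> 1" "norm (Z (h n)) \<le> 1" for n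
    using norm_X_le[of "h n"] norm_Y_le[of "h n"] norm_Z_le[of "h n"] by (simp_all add: h1)
  have "(\<lambda>n. u.modsq z1 z2 (Y (h n))) \<longlonglongrightarrow> 0" "(\<lambda>n. u.modsq z1 z2 (Z (h n))) \<longlonglongrightarrow> 0"
    using component_null(2,3)[OF Sc S_null] by (simp_all add: Y_modsq Z_modsq)
  then have NY: "(\<lambda>n. N1 (Y (h n))) \<longlonglongrightarrow> 0" "(\<lambda>n. N2 (Y (h n))) \<longlonglongrightarrow> 0"
    and NZ: "(\<lambda>n. N1 (Z (h n))) \<longlonglongrightarrow> 0" "(\<lambda>n. N2 (Z (h n))) \<longlonglongrightarrow> 0"
    using N_null[of "\<lambda>n. Y (h n)"] N_null[of "\<lambda>n. Z (h n)"] bounds by simp_all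
  have "(\<lambda>n. coupling z1 z2 (h n)) \<longlonglongrightarrow> 0"
    unfolding coupling_def
  proof (intro tendsto_add_zero scaleR_null_sequence)
    show "(\<lambda>n. angular_derivative U1 W1 z1 (Y (h n))) \<longlonglongrightarrow> 0"
      by (rule Lim_null_comparison[OF _ tendsto_mult_right_zero[OF tendsto_norm_zero[OF NY(1)], of 2]])
        (simp add: u.u1.norm_angular_derivative_unimodular[OF z(1)] N1_def)
    show "(\<lambda>n. angular_derivative U2 W2 z2 (Z (h n))) \<longlonglongrightarrow> 0"
      by (rule Lim_null_comparison[OF _ tendsto_mult_right_zero[OF tendsto_norm_zero[OF NZ(2)], of 2]])
        (simp add: u.u2.norm_angular_derivative_unimodular[OF z(2)] N2_def)
  qed
  from tendsto_diff[OF component_null(1)[OF Sc S_null] this]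
  have "(\<lambda>n. u.modsq z1 z2 (X (h n))) \<longlonglongrightarrow> 0" by (simp add: X_modsq)
  then have NX: "(\<lambda>n. N1 (X (h n))) \<longlonglongrightarrow> 0" "(\<lambda>n. N2 (X (h n))) \<longlonglongrightarrow> 0"
    using N_null[of "\<lambda>n. X (h n)"] bounds by simp_all
  note null_intros = tendsto_add_zero scaleR_null_sequence NX NY NZ
    operator_on_null_sequence[OF N_ops(1)] operator_on_null_sequence[OF N_ops(2)]
    operator_on_null_sequence[OF u.o1.T_op] operator_on_null_sequence[OF u.o2.T_op]
  have "(\<lambda>n. M1 (M1 (h n))) \<longlonglongrightarrow> 0" "(\<lambda>n. M2 (M1 (h n))) \<longlonglongrightarrow> 0"
    "(\<lambda>n. M1 (M2 (h n))) \<longlonglongrightarrow> 0" "(\<lambda>n. M2 (M2 (h n))) \<longlonglongrightarrow> 0"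
    by (rule null_if_components; simp add: X_M Y_M Z_M N_U; intro null_intros; simp)+
  then have "(\<lambda>n. M1 (h n)) \<longlonglongrightarrow> 0" "(\<lambda>n. M2 (h n)) \<longlonglongrightarrow> 0"
    using null_if_M[of "\<lambda>n. M1 (h n)"] null_if_M[of "\<lambda>n. M2 (h n)"] by simp_all
  then have "h \<longlonglongrightarrow> 0" by (rule null_if_M[rotated]) simp_all
  then have "(\<lambda>n. norm (h n)) \<longlonglongrightarrow> 0" by (rule tendsto_norm_zero)
  then show False by (simp add: h1 LIMSEQ_const_iff)
qed

text \<open>
  An operator bounded below can fail to be onto, but \<open>modsq\<close> is the limit of the surjective
  operators \<open>modsq + \<tau>\<close> as \<open>\<tau>\<close> decreases to \<open>0\<close>, since \<open>modsq\<close> of the unitaries is nonnegative. For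
  \<open>\<tau> = e / 3\<close> the solutions of the perturbed equation solve the original one up to half of the
  right-hand side.
\<close>

lemma modsq_bijective:
  assumes e: "e > 0" and below: "\<And>h. h \<in> H \<Longrightarrow> e * norm h \<le> norm (t.modsq z1 z2 h)"
  shows "t.modsq z1 z2 ` H = H"
proof
  show "t.modsq z1 z2 ` H \<subseteq> H" by (rule image_subsetI) simp
  define \<tau> where "\<tau> = e / 3"
  have \<tau>: "\<tau> > 0" using e by (simp add: \<tau>_def)
  have "\<tau> * (norm x)\<^sup>2 \<le> inner (u.modsq z1 z2 x) x + \<tau> * (norm x)\<^sup>2" if "x \<in> F" for x
    using that by (simp add: u.inner_modsq_self)
  note onto = shifted_modsq_bijective(1)[OF \<tau> this]
  obtain B where B: "B > 0" "\<And>h. h \<in> H \<Longrightarrow> norm (t.modsq z1 z2 h) \<le> B * norm h"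
    using operator_on_bound[OF t.modsq_op] by blast
  show "H \<subseteq> t.modsq z1 z2 ` H"
  proof
    fix y assume y: "y \<in> H"
    have "\<exists>x\<in>H. t.modsq z1 z2 x = y \<and> norm x \<le> (3 / (2 * e)) * norm y / (1 - 1 / 2)"
    proof (rule successive_approximation[where Y = H and m = 1 and p = norm])
      show "subspace H" "closed H"
        by (rule hilbert_space_on_subspace[OF t.o1.space] hilbert_space_on_closed[OF t.o1.space])+
      fix g assume g: "g \<in> H"
      then obtain x where x: "x \<in> H" "g = t.modsq z1 z2 x + \<tau> *\<^sub>R x" using onto by blast
      have "norm (t.modsq z1 z2 x) \<le> norm g + \<tau> * norm x"
        using norm_triangle_ineq4[of g "\<tau> *\<^sub>R x"] \<tau> by (simp add: x(2))
      then have "e * norm x \<le> norm g + \<tau> * norm x" using below[OF x(1)] by linarith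
      then have le: "norm x \<le> (3 / (2 * e)) * norm g" using e by (simp add: \<tau>_def field_simps)
      moreover have "norm (g - t.modsq z1 z2 x) \<le> 1 / 2 * norm g"
        using mult_left_mono[OF le, of \<tau>] \<tau> e by (simp add: x(2) \<tau>_def)
      ultimately show "\<exists>x\<in>H. norm x \<le> 3 / (2 * e) * norm g \<and> g - t.modsq z1 z2 x \<in> H \<and>
          norm (g - t.modsq z1 z2 x) \<le> 1 / 2 * norm g"
        using x(1) g by (intro bexI[of _ x]) simp_all
    qed (use e B y in simp_all)
    then show "y \<in> t.modsq z1 z2 ` H" by blast
  qed
qed

text \<open>
  Inverting \<open>modsq\<close> on \<open>H\<close> gives backward orbits \<open>g\<close> there. The components \<open>Y\<close> and \<open>Z\<close> carry them to
  backward orbits in \<open>F\<close>. For \<open>X\<close> the coupling has to be corrected: applying the \<open>n\<close>-th power of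
  the triangular operator to \<open>g n\<close> shows that \<open>X (g n)\<close> plus \<open>n\<close> times the coupling of \<open>g (n + 1)\<close>
  is the backward orbit of \<open>X h\<close>.
\<close>

lemma components_in_backward_orbits:
  assumes e: "e > 0" and below: "\<And>h. h \<in> H \<Longrightarrow> e * norm h \<le> norm (t.modsq z1 z2 h)"
    and h: "h \<in> H"
  shows "X h \<in> u.backward_orbits z1 z2 e" "Y h \<in> u.backward_orbits z1 z2 e"
    "Z h \<in> u.backward_orbits z1 z2 e"
proof -
  have "\<forall>y\<in>H. \<exists>x\<in>H. t.modsq z1 z2 x = y" using modsq_bijective[OF e below] by (metis imageE)
  then obtain R where R: "\<And>y. y \<in> H \<Longrightarrow> R y \<in> H" "\<And>y. y \<in> H \<Longrightarrow> t.modsq z1 z2 (R y) = y" by metis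
  define g where "g n = (R ^^ n) h" for n
  have g0: "g 0 = h" by (simp add: g_def)
  have gH [simp]: "g n \<in> H" for n by (induction n) (simp_all add: g_def h R)
  have step: "t.modsq z1 z2 (g (Suc n)) = g n" for n
    using R(2)[OF gH[of n]] by (simp add: g_def)
  have bound: "norm (g n) \<le> norm h / e ^ n" for n
  proof (induction n)
    case (Suc n)
    have "e * norm (g (Suc n)) \<le> norm h / e ^ n" using below[OF gH[of "Suc n"]] Suc by (simp add: step)
    then show ?case using e by (simp add: field_simps)
  qed (simp add: g0)
  have weaken: "norm h / e ^ n \<le> norm h * (real n + 1) / e ^ n" for n
    using e by (intro divide_right_mono) (simp_all add: mult_le_cancel_left1)
  have "Y (g 0) \<in> u.backward_orbits z1 z2 e"
  proof (rule u.backward_orbitsI[of "\<lambda>n. Y (g n)" z1 z2 "norm h"])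
    show "norm (Y (g n)) \<le> norm h * (real n + 1) / e ^ n" for n
      using norm_Y_le[OF gH[of n]] bound[of n] weaken[of n] by linarith
  qed (simp_all add: Y_modsq[symmetric] step)
  then show "Y h \<in> u.backward_orbits z1 z2 e" by (simp add: g0)
  have "Z (g 0) \<in> u.backward_orbits z1 z2 e"
  proof (rule u.backward_orbitsI[of "\<lambda>n. Z (g n)" z1 z2 "norm h"])
    show "norm (Z (g n)) \<le> norm h * (real n + 1) / e ^ n" for n
      using norm_Z_le[OF gH[of n]] bound[of n] weaken[of n] by linarith
  qed (simp_all add: Z_modsq[symmetric] step)
  then show "Z h \<in> u.backward_orbits z1 z2 e" by (simp add: g0)
  define v where "v n = u.modsq z1 z2 (X (g (Suc n))) + (real n + 1) *\<^sub>R coupling z1 z2 (g (Suc n))" for n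
  have coupling_step: "u.modsq z1 z2 (coupling z1 z2 (g (Suc n))) = coupling z1 z2 (g n)" for n
  proof -
    have D1: "u.modsq z1 z2 (angular_derivative U1 W1 z1 a) = angular_derivative U1 W1 z1 (u.modsq z1 z2 a)"
      and D2: "u.modsq z1 z2 (angular_derivative U2 W2 z2 a) = angular_derivative U2 W2 z2 (u.modsq z1 z2 a)"
      if a: "a \<in> F" for a
    proof -
      have S: "clinear_between F F (u.modsq z1 z2)" using operator_on_clinear[OF u.modsq_op] .
      have "u.modsq z1 z2 (U1 y) = U1 (u.modsq z1 z2 y)" if "y \<in> F" for y
        using u.modsq_commute[OF operator_on_clinear[OF u.o1.T_op] _ _ that] u.commute by metis
      then show "u.modsq z1 z2 (angular_derivative U1 W1 z1 a) = angular_derivative U1 W1 z1 (u.modsq z1 z2 a)"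
        by (intro u.o1.angular_derivative_commute[OF S _ a])
      have "u.modsq z1 z2 (U2 y) = U2 (u.modsq z1 z2 y)" if "y \<in> F" for y
        using u.modsq_commute[OF operator_on_clinear[OF u.o2.T_op] _ _ that] u.commute by metis
      then show "u.modsq z1 z2 (angular_derivative U2 W2 z2 a) = angular_derivative U2 W2 z2 (u.modsq z1 z2 a)"
        by (intro u.o2.angular_derivative_commute[OF S _ a])
    qed
    have inF: "angular_derivative U1 W1 z1 a \<in> F" "angular_derivative U2 W2 z2 a \<in> F" if "a \<in> F" for a
      using that operator_on_clinear[OF u.o1.angular_derivative_op]
        operator_on_clinear[OF u.o2.angular_derivative_op] by (simp_all add: clinear_between_def)
    show ?thesis
      by (simp add: coupling_def inF D1 D2 Y_modsq[symmetric] Z_modsq[symmetric] step)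
  qed
  have Xg: "X (g n) = u.modsq z1 z2 (X (g (Suc n))) + coupling z1 z2 (g (Suc n))" for n
    using X_modsq[OF gH[of "Suc n"], of z1 z2] by (simp add: step)
  define C where "C = 2 * \<bar>c\<bar> * cmod z1 + 2 * \<bar>d\<bar> * cmod z2"
  have C: "C \<ge> 0" by (simp add: C_def)
  have norm_coupling: "norm (coupling z1 z2 (g (Suc n))) \<le> 2 * C * (norm h / e ^ Suc n)" for n
  proof -
    have "norm (coupling z1 z2 (g (Suc n))) \<le> C * norm (Y (g (Suc n))) + C * norm (Z (g (Suc n)))"
      by (rule norm_coupling_le[OF gH C_def])
    also have "\<dots> \<le> C * (norm h / e ^ Suc n) + C * (norm h / e ^ Suc n)"
      using C norm_Y_le[OF gH[of "Suc n"]] norm_Z_le[OF gH[of "Suc n"]] bound[of "Suc n"]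
      by (intro add_mono mult_left_mono) linarith+
    finally show ?thesis by simp
  qed
  have v_eq: "v n = X (g n) + real n *\<^sub>R coupling z1 z2 (g (Suc n))" for n
    unfolding v_def Xg[of n] by (simp add: scaleR_add_left)
  have "v 0 \<in> u.backward_orbits z1 z2 e"
  proof (rule u.backward_orbitsI[of v z1 z2 "norm h * (1 + 2 * C / e)"])
    show "v n \<in> F" for n by (simp add: v_def coupling_in)
    show "u.modsq z1 z2 (v (Suc n)) = v n" for n
      unfolding v_eq[of "Suc n"] unfolding v_def by (simp add: coupling_in coupling_step)
    show "norm (v n) \<le> (norm h * (1 + 2 * C / e)) * (real n + 1) / e ^ n" for n
    proof -
      have "norm (v n) \<le> norm (X (g n)) + real n * norm (coupling z1 z2 (g (Suc n)))"
        unfolding v_eq by (rule norm_triangle_le) simp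
      also have "\<dots> \<le> norm h / e ^ n + real n * (2 * C * (norm h / e ^ Suc n))"
        using norm_X_le[OF gH[of n]] bound[of n] norm_coupling[of n]
        by (intro add_mono mult_left_mono) linarith+
      also have "\<dots> = (norm h / e ^ n) * (1 + real n * (2 * C / e))"
      proof -
        have "q + real n * (2 * C * (q / e)) = q * (1 + real n * (2 * C / e))" for q
          by (simp add: distrib_left)
        from this[of "norm h / e ^ n"] show ?thesis by (simp add: mult.commute)
      qed
      also have "\<dots> \<le> (norm h / e ^ n) * ((1 + 2 * C / e) * (real n + 1))"
      proof (rule mult_left_mono)
        have "1 + real n * t \<le> (1 + t) * (real n + 1)" if "t \<ge> 0" for t
          using that by (simp add: algebra_simps)
        moreover have "2 * C / e \<ge> 0" using e C by simp
        ultimately show "1 + real n * (2 * C / e) \<le> (1 + 2 * C / e) * (real n + 1)" by blast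
      qed (use e in simp)
      also have "\<dots> = (norm h * (1 + 2 * C / e)) * (real n + 1) / e ^ n" by simp
      finally show ?thesis .
    qed
  qed
  then show "X h \<in> u.backward_orbits z1 z2 e" by (simp add: v_eq g0)
qed

text \<open>
  Off the torus the unitaries themselves are jointly bounded below and \<open>F\<close> serves as \<open>E\<close>. On the
  torus \<open>E\<close> is the closure of the slowly growing backward orbits of \<open>modsq\<close>.
\<close>

lemma koszul_exact_imp_localized:
  assumes ex: "koszul_exact H (\<lambda>x. T1 x - z1 *\<^sub>C x) (\<lambda>x. T2 x - z2 *\<^sub>C x)"
  shows "\<exists>E. u.reducing E \<and> (\<forall>h\<in>H. X h \<in> E \<and> Y h \<in> E \<and> Z h \<in> E) \<and>
    jointly_bounded_below E (\<lambda>x. U1 x - z1 *\<^sub>C x) (\<lambda>x. U2 x - z2 *\<^sub>C x)"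
proof (cases "cmod z1 = 1 \<and> cmod z2 = 1")
  case True
  then have z: "cmod z1 = 1" "cmod z2 = 1" by simp_all
  obtain e where e: "e > 0" "\<And>h. h \<in> H \<Longrightarrow> e * norm h \<le> norm (t.modsq z1 z2 h)"
    using modsq_bounded_below[OF z koszul_exact_imp_jointly_bounded_below[OF t.o1.space
        t.o1.shift_op t.o2.shift_op ex]] by blast
  define E where "E = closure (u.backward_orbits z1 z2 e)"
  have red: "u.reducing E" unfolding E_def by (rule u.reducing_closure_backward_orbits[OF e(1)])
  have "e\<^sup>2 / 8 * (norm x)\<^sup>2 \<le> (norm (U1 x - z1 *\<^sub>C x))\<^sup>2 + (norm (U2 x - z2 *\<^sub>C x))\<^sup>2"
    if xE: "x \<in> E" for x
  proof -
    have x: "x \<in> F" using red xE by (auto simp: u.reducing_def)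
    define a b where "a = U1 x - z1 *\<^sub>C x" and "b = U2 x - z2 *\<^sub>C x"
    have ab: "a \<in> F" "b \<in> F" using x by (simp_all add: a_def b_def)
    have "u.modsq z1 z2 x = (W1 a - cnj z1 *\<^sub>C a) + (W2 b - cnj z2 *\<^sub>C b)"
      by (simp add: u.modsq_def modulus_square_def a_def b_def)
    then have "norm (u.modsq z1 z2 x) \<le> (norm (W1 a) + norm (cnj z1 *\<^sub>C a)) + (norm (W2 b) + norm (cnj z2 *\<^sub>C b))"
      by (simp only:) (intro norm_triangle_mono norm_triangle_ineq4)
    then have "norm (u.modsq z1 z2 x) \<le> 2 * (norm a + norm b)"
      using ab z by (simp add: norm_scaleC)
    moreover have "e * norm x \<le> norm (u.modsq z1 z2 x)"
      using u.closure_backward_orbits_bounded_below[OF e(1)] xE by (simp add: E_def)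
    ultimately have "(e * norm x)\<^sup>2 \<le> (2 * (norm a + norm b))\<^sup>2"
      using e(1) by (intro power_mono) auto
    also have "\<dots> \<le> 8 * ((norm a)\<^sup>2 + (norm b)\<^sup>2)"
      using zero_le_power2[of "norm a - norm b"] by (simp add: power2_eq_square algebra_simps)
    finally show ?thesis by (simp add: a_def b_def power_mult_distrib)
  qed
  then have "jointly_bounded_below E (\<lambda>x. U1 x - z1 *\<^sub>C x) (\<lambda>x. U2 x - z2 *\<^sub>C x)"
    unfolding jointly_bounded_below_def using e(1) by (intro exI[of _ "e\<^sup>2 / 8"]) simp
  then show ?thesis
    using red components_in_backward_orbits[OF e] closure_subset unfolding E_def by blast
next
  case False
  define r where "r = (1 - cmod z1)\<^sup>2 + (1 - cmod z2)\<^sup>2"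
  have r: "r > 0" using False unfolding r_def
    by (metis eq_iff_diff_eq_0 sum_power2_gt_zero_iff)
  have "r * (norm x)\<^sup>2 \<le> (norm (U1 x - z1 *\<^sub>C x))\<^sup>2 + (norm (U2 x - z2 *\<^sub>C x))\<^sup>2" if "x \<in> F" for x
    using power_mono[OF u.u1.norm_shift_ge[OF that, of z1], of 2]
      power_mono[OF u.u2.norm_shift_ge[OF that, of z2], of 2]
    by (simp add: r_def distrib_right power_mult_distrib)
  then have "jointly_bounded_below F (\<lambda>x. U1 x - z1 *\<^sub>C x) (\<lambda>x. U2 x - z2 *\<^sub>C x)"
    unfolding jointly_bounded_below_def using r by blast
  moreover have "u.reducing F" by (simp add: u.reducing_def u.o1.space)
  ultimately show ?thesis by (intro exI[of _ F]) simp
qed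

end

section \<open>The Taylor spectrum of a Jordan pair\<close>

lemma invertible_on_imp_inverse_operators:
  assumes "hilbert_space_on S" "invertible_on S T"
  shows "\<exists>R. inverse_operators S T R"
  using assms unfolding invertible_on_def inverse_operators_def by blast

lemma unitary_on_imp_unitary_operator:
  assumes F: "hilbert_space_on F" and U: "unitary_on F U"
  shows "\<exists>W. unitary_operator F U W"
proof -
  have U_op: "operator_on F U" and onto: "U ` F = F"
    and iso: "\<And>x y. x \<in> F \<Longrightarrow> y \<in> F \<Longrightarrow> cinner (U x) (U y) = cinner x y"
    using U by (auto simp: unitary_on_def)
  note linU = clinear_between_arith[OF F operator_on_clinear[OF U_op]]
  have norm_U: "norm (U x) = norm x" if "x \<in> F" for x
    using iso[OF that that] unfolding cinner_self of_real_eq_iff by simp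
  have inj: "inj_on U F"
  proof (rule inj_onI)
    fix x y assume xy: "x \<in> F" "y \<in> F" "U x = U y"
    then have "norm (U (x - y)) = 0" by (simp add: linU)
    then show "x = y" using norm_U[OF hilbert_space_on_diff[OF F xy(1,2)]] by simp
  qed
  define W where "W = inv_into F U"
  have W_in: "W x \<in> F" and UW: "U (W x) = x" if "x \<in> F" for x
    using that onto by (auto simp: W_def inv_into_into f_inv_into_f)
  have WU: "W (U x) = x" if "x \<in> F" for x
    using that inj by (simp add: W_def)
  have "operator_on F W"
  proof (rule operator_onI[where B = 1])
    have "W (x + y) = W x + W y" if "x \<in> F" "y \<in> F" for x y
      using WU[of "W x + W y"] that by (simp add: linU W_in UW hilbert_space_on_add[OF F])
    moreover have "W (a *\<^sub>C x) = a *\<^sub>C W x" if "x \<in> F" for a x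
      using WU[of "a *\<^sub>C W x"] that by (simp add: linU W_in UW hilbert_space_on_scaleC[OF F])
    ultimately show "clinear_between F F W" by (simp add: clinear_between_def W_in)
    show "norm (W x) \<le> 1 * norm x" if "x \<in> F" for x
      using norm_U[OF W_in[OF that]] by (simp add: UW that)
  qed
  then have "unitary_operator F U W"
    by (unfold_locales) (simp_all add: F U_op UW WU iso)
  then show ?thesis by blast
qed

lemma hilbert_space_on_times:
  "hilbert_space_on E \<Longrightarrow> hilbert_space_on F \<Longrightarrow> hilbert_space_on (E \<times> F)"
  by (auto simp: hilbert_space_on_def scaleC_prod_def closed_Times mem_Times_iff)

lemma operator_on_upper_triangular:
  assumes F: "hilbert_space_on F" and A: "operator_on F A"
    and J: "\<And>x y z. x \<in> F \<Longrightarrow> y \<in> F \<Longrightarrow> z \<in> F \<Longrightarrow>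
      J (x, y, z) = (A x + a *\<^sub>R A y + b *\<^sub>R A z, A y, A z)"
  shows "operator_on (F \<times> F \<times> F) J"
proof -
  note [simp] = hilbert_space_on_closure[OF F]
    clinear_between_arith[OF F operator_on_clinear[OF A]]
  obtain B where B: "B > 0" "\<And>x. x \<in> F \<Longrightarrow> norm (A x) \<le> B * norm x"
    using operator_on_bound[OF A] by blast
  show ?thesis
  proof (rule operator_onI)
    show "clinear_between (F \<times> F \<times> F) (F \<times> F \<times> F) J"
      by (auto simp: clinear_between_def J scaleC_prod_def scaleC_add_right scaleR_add_right
          scaleC_scaleR_commute)
    fix p assume "p \<in> F \<times> F \<times> F"
    then obtain x y z where p: "p = (x, y, z)" "x \<in> F" "y \<in> F" "z \<in> F" by auto
    have le: "norm x \<le> norm p" "norm y \<le> norm p" "norm z \<le> norm p"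
      using norm_fst_le[of x "(y, z)"] norm_snd_le[of "(y, z)" x] norm_fst_le[of y z] norm_snd_le[of z y]
      unfolding p by linarith+
    have A_le: "norm (A v) \<le> B * norm p" if "v \<in> F" "norm v \<le> norm p" for v
      using B(2)[OF that(1)] mult_left_mono[OF that(2), of B] B(1) by linarith
    have "norm (J p) \<le> norm (A x + a *\<^sub>R A y + b *\<^sub>R A z) + (norm (A y) + norm (A z))"
      unfolding p(1) J[OF p(2,3,4)] by (meson add_left_mono norm_Pair_le order_trans)
    also have "\<dots> \<le> (norm (A x) + \<bar>a\<bar> * norm (A y) + \<bar>b\<bar> * norm (A z)) + (norm (A y) + norm (A z))"
      by (intro add_mono norm_triangle_le) simp_all
    also have "\<dots> \<le> (B * norm p + \<bar>a\<bar> * (B * norm p) + \<bar>b\<bar> * (B * norm p)) + (B * norm p + B * norm p)"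
      by (intro add_mono mult_left_mono A_le p le) simp_all
    also have "\<dots> = (B * (3 + \<bar>a\<bar> + \<bar>b\<bar>)) * norm p" by (simp add: algebra_simps)
    finally show "norm (J p) \<le> (B * (3 + \<bar>a\<bar> + \<bar>b\<bar>)) * norm p" .
  qed
qed

locale jordan_pair = unitary_pair F U1 W1 U2 W2
  for F :: "'f::complex_hilbert set" and U1 W1 U2 W2 +
  fixes J1 J2 :: "'f \<times> 'f \<times> 'f \<Rightarrow> 'f \<times> 'f \<times> 'f" and c d :: real
  assumes J1_eq: "x \<in> F \<Longrightarrow> y \<in> F \<Longrightarrow> z \<in> F \<Longrightarrow> J1 (x, y, z) = (U1 x + c *\<^sub>R U1 y, U1 y, U1 z)"
    and J2_eq: "x \<in> F \<Longrightarrow> y \<in> F \<Longrightarrow> z \<in> F \<Longrightarrow> J2 (x, y, z) = (U2 x + d *\<^sub>R U2 z, U2 y, U2 z)"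
begin

lemma unitary_on_U1: "unitary_on F U1" and unitary_on_U2: "unitary_on F U2"
proof -
  have "U1 ` F = F" "U2 ` F = F"
    using o1.T_R o2.T_R o1.R_simps(1) o2.R_simps(1) o1.T_simps(1) o2.T_simps(1)
    by (metis image_eqI image_subsetI subsetI subset_antisym)+
  then show "unitary_on F U1" "unitary_on F U2"
    by (simp_all add: unitary_on_def o1.T_op o2.T_op u1.isometric u2.isometric)
qed

lemma in_jordan_class: "jordan_class c d (F \<times> F \<times> F) J1 J2"
  unfolding jordan_class_def
  using o1.space unitary_on_U1 unitary_on_U2 commute J1_eq J2_eq
  by (intro exI[of _ F] exI[of _ U1] exI[of _ U2]) (simp add: commute_on_def)

lemma commuting_inverses_jordan:
  "\<exists>R1 R2. commuting_inverses (F \<times> F \<times> F) J1 R1 J2 R2"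
proof -
  define R1 where "R1 = (\<lambda>(x, y, z). (W1 x + (- c) *\<^sub>R W1 y, W1 y, W1 z))"
  define R2 where "R2 = (\<lambda>(x, y, z). (W2 x + (- d) *\<^sub>R W2 z, W2 y, W2 z))"
  have "operator_on (F \<times> F \<times> F) J1"
    by (rule operator_on_upper_triangular[OF o1.space o1.T_op, of _ c 0]) (simp add: J1_eq)
  moreover have "operator_on (F \<times> F \<times> F) J2"
    by (rule operator_on_upper_triangular[OF o1.space o2.T_op, of _ 0 d]) (simp add: J2_eq)
  moreover have "operator_on (F \<times> F \<times> F) R1"
    by (rule operator_on_upper_triangular[OF o1.space o1.R_op, of _ "- c" 0]) (simp add: R1_def)
  moreover have "operator_on (F \<times> F \<times> F) R2"
    by (rule operator_on_upper_triangular[OF o1.space o2.R_op, of _ 0 "- d"]) (simp add: R2_def)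
  moreover have "hilbert_space_on (F \<times> F \<times> F)"
    by (intro hilbert_space_on_times o1.space)
  ultimately have "commuting_inverses (F \<times> F \<times> F) J1 R1 J2 R2"
    by unfold_locales
      (auto simp: R1_def R2_def J1_eq J2_eq commute scaleR_add_right)
  then show ?thesis by blast
qed

lemma jordan_liftI:
  assumes T: "commuting_inverses H T1 R1 T2 R2"
    and V: "isometry_between H (F \<times> F \<times> F) V"
    and VT: "\<And>h. h \<in> H \<Longrightarrow> V (T1 h) = J1 (V h)" "\<And>h. h \<in> H \<Longrightarrow> V (T2 h) = J2 (V h)"
  shows "jordan_lift H T1 R1 T2 R2 F U1 W1 U2 W2
    (\<lambda>h. fst (V h)) (\<lambda>h. fst (snd (V h))) (\<lambda>h. snd (snd (V h))) c d"
proof -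
  interpret t: commuting_inverses H T1 R1 T2 R2 by fact
  have V_lin: "clinear_between H (F \<times> F \<times> F) V" and V_norm: "\<And>h. h \<in> H \<Longrightarrow> norm (V h) = norm h"
    using V by (simp_all add: isometry_between_def)
  note [simp] = clinear_between_add[OF t.o1.space V_lin] clinear_between_scaleC[OF t.o1.space V_lin]
  have mem: "fst (V h) \<in> F" "fst (snd (V h)) \<in> F" "snd (snd (V h)) \<in> F" if "h \<in> H" for h
    using clinear_between_in[OF t.o1.space V_lin that] by auto
  have J: "J1 (V h) = (U1 (fst (V h)) + c *\<^sub>R U1 (fst (snd (V h))), U1 (fst (snd (V h))), U1 (snd (snd (V h))))"
    "J2 (V h) = (U2 (fst (V h)) + d *\<^sub>R U2 (snd (snd (V h))), U2 (fst (snd (V h))), U2 (snd (snd (V h))))"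
    if "h \<in> H" for h
    using J1_eq[OF mem[OF that]] J2_eq[OF mem[OF that]] by simp_all
  show ?thesis
  proof unfold_locales
    show "clinear_between H F (\<lambda>h. fst (V h))" "clinear_between H F (\<lambda>h. fst (snd (V h)))"
      "clinear_between H F (\<lambda>h. snd (snd (V h)))"
      by (simp_all add: clinear_between_def mem scaleC_prod_def)
    show "(norm h)\<^sup>2 = (norm (fst (V h)))\<^sup>2 + (norm (fst (snd (V h))))\<^sup>2 + (norm (snd (snd (V h))))\<^sup>2"
      if "h \<in> H" for h
      unfolding V_norm[OF that, symmetric] by (simp add: norm_prod_def)
  qed (simp_all add: VT J)
qed

text \<open>
  The Taylor spectrum of a Jordan pair is the joint spectrum of its unitaries. One direction lifts
  the Jordan pair to itself; the other restricts to the vectors \<open>(x, 0, 0)\<close>, on which the Jordan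
  pair acts as the unitaries.
\<close>

lemma koszul_exact_iff:
  "koszul_exact (F \<times> F \<times> F) (\<lambda>p. J1 p - z1 *\<^sub>C p) (\<lambda>p. J2 p - z2 *\<^sub>C p) \<longleftrightarrow>
    jointly_bounded_below F (\<lambda>x. U1 x - z1 *\<^sub>C x) (\<lambda>x. U2 x - z2 *\<^sub>C x)"
proof -
  obtain R1 R2 where R: "commuting_inverses (F \<times> F \<times> F) J1 R1 J2 R2"
    using commuting_inverses_jordan by blast
  interpret j: commuting_inverses "F \<times> F \<times> F" J1 R1 J2 R2 by fact
  show ?thesis
  proof
    assume "jointly_bounded_below F (\<lambda>x. U1 x - z1 *\<^sub>C x) (\<lambda>x. U2 x - z2 *\<^sub>C x)"
    moreover have "isometry_between (F \<times> F \<times> F) (F \<times> F \<times> F) (\<lambda>p. p)"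
      by (simp add: isometry_between_def clinear_between_def)
    ultimately show "koszul_exact (F \<times> F \<times> F) (\<lambda>p. J1 p - z1 *\<^sub>C p) (\<lambda>p. J2 p - z2 *\<^sub>C p)"
      using jordan_lift.koszul_exact_if_jointly_bounded_below[OF jordan_liftI[OF R]] by blast
  next
    assume "koszul_exact (F \<times> F \<times> F) (\<lambda>p. J1 p - z1 *\<^sub>C p) (\<lambda>p. J2 p - z2 *\<^sub>C p)"
    then have "jointly_bounded_below (F \<times> F \<times> F) (\<lambda>p. J1 p - z1 *\<^sub>C p) (\<lambda>p. J2 p - z2 *\<^sub>C p)"
      by (rule koszul_exact_imp_jointly_bounded_below[OF j.o1.space j.o1.shift_op j.o2.shift_op])
    then obtain e where e: "e > 0" "\<And>p. p \<in> F \<times> F \<times> F \<Longrightarrow>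
        e * (norm p)\<^sup>2 \<le> (norm (J1 p - z1 *\<^sub>C p))\<^sup>2 + (norm (J2 p - z2 *\<^sub>C p))\<^sup>2"
      unfolding jointly_bounded_below_def by blast
    have "e * (norm x)\<^sup>2 \<le> (norm (U1 x - z1 *\<^sub>C x))\<^sup>2 + (norm (U2 x - z2 *\<^sub>C x))\<^sup>2" if "x \<in> F" for x
      using e(2)[of "(x, 0, 0)"] that
      by (simp add: J1_eq J2_eq scaleC_prod_def norm_Pair)
    then show "jointly_bounded_below F (\<lambda>x. U1 x - z1 *\<^sub>C x) (\<lambda>x. U2 x - z2 *\<^sub>C x)"
      unfolding jointly_bounded_below_def using e(1) by blast
  qed
qed

lemma taylor_spectrum_subset:
  assumes T: "commuting_inverses H T1 R1 T2 R2"
    and V: "isometry_between H (F \<times> F \<times> F) V"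
    and VT: "\<And>h. h \<in> H \<Longrightarrow> V (T1 h) = J1 (V h)" "\<And>h. h \<in> H \<Longrightarrow> V (T2 h) = J2 (V h)"
  shows "taylor_spectrum H T1 T2 \<subseteq> taylor_spectrum (F \<times> F \<times> F) J1 J2"
  using jordan_lift.koszul_exact_if_jointly_bounded_below[OF jordan_liftI[OF assms]]
  by (auto simp: taylor_spectrum_def koszul_exact_iff)

lemma restrict_to_reducing:
  assumes "reducing E"
  shows "jordan_pair E U1 W1 U2 W2 J1 J2 c d"
proof -
  have E: "hilbert_space_on E" "E \<subseteq> F"
    "\<And>x. x \<in> E \<Longrightarrow> U1 x \<in> E" "\<And>x. x \<in> E \<Longrightarrow> W1 x \<in> E"
    "\<And>x. x \<in> E \<Longrightarrow> U2 x \<in> E" "\<And>x. x \<in> E \<Longrightarrow> W2 x \<in> E"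
    using assms by (auto simp: reducing_def)
  have op: "operator_on E A" if "operator_on F A" "\<And>x. x \<in> E \<Longrightarrow> A x \<in> E" for A
    using that E(2) unfolding operator_on_def clinear_between_def by (meson subsetD)
  have F: "x \<in> F" if "x \<in> E" for x using that E(2) by blast
  show ?thesis
    by unfold_locales
      (simp_all add: E F op o1.T_op o1.R_op o2.T_op o2.R_op commute u1.isometric u2.isometric J1_eq J2_eq)
qed

lemma reducing_whole: "reducing F"
  by (simp add: reducing_def o1.space)

lemma reducing_Inter:
  assumes "\<F> \<noteq> {}" "\<And>E. E \<in> \<F> \<Longrightarrow> reducing E"
  shows "reducing (\<Inter> \<F>)"
proof -
  have "hilbert_space_on (\<Inter> \<F>)"
    using assms(2) by (auto simp: hilbert_space_on_def reducing_def intro!: closed_Inter)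
  then show ?thesis using assms unfolding reducing_def by blast
qed

end

theorem proposition7:
  fixes H :: "'h::complex_hilbert set"
    and T1 T2 :: "'h \<Rightarrow> 'h"
    and K :: "('f::complex_hilbert \<times> 'f \<times> 'f) set"
    and J1 J2 :: "'f \<times> 'f \<times> 'f \<Rightarrow> 'f \<times> 'f \<times> 'f"
    and c d :: real
  assumes "hilbert_space_on H"
    and "invertible_on H T1" and "invertible_on H T2"
    and "commute_on H T1 T2"
    and "c > 0" and "d > 0"
    and "jordan_class c d K J1 J2"
    and "lifts H T1 T2 K J1 J2"
  shows "taylor_spectrum H T1 T2 \<subseteq> taylor_spectrum K J1 J2 \<and>
    (\<exists>(K' :: ('f \<times> 'f \<times> 'f) set) J1' J2'.
       jordan_class c d K' J1' J2' \<and> lifts H T1 T2 K' J1' J2' \<and>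
       taylor_spectrum H T1 T2 = taylor_spectrum K' J1' J2')"
proof -
  obtain R1 R2 where "inverse_operators H T1 R1" "inverse_operators H T2 R2"
    using invertible_on_imp_inverse_operators assms(1-3) by metis
  then have T: "commuting_inverses H T1 R1 T2 R2"
    using assms(4) by (simp add: commuting_inverses_def commuting_inverses_axioms_def commute_on_def)
  obtain F U1 U2 where F: "hilbert_space_on F" and U: "unitary_on F U1" "unitary_on F U2"
    and comm: "commute_on F U1 U2" and K: "K = F \<times> F \<times> F"
    and J: "\<forall>x\<in>F. \<forall>y\<in>F. \<forall>z\<in>F. J1 (x, y, z) = (U1 x + c *\<^sub>R U1 y, U1 y, U1 z) \<and>
           J2 (x, y, z) = (U2 x + d *\<^sub>R U2 z, U2 y, U2 z)"
    using assms(7) unfolding jordan_class_def by blast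
  obtain W1 W2 where W: "unitary_operator F U1 W1" "unitary_operator F U2 W2"
    using unitary_on_imp_unitary_operator[OF F] U by metis
  obtain V where V: "isometry_between H (F \<times> F \<times> F) V"
    and VT: "\<And>h. h \<in> H \<Longrightarrow> V (T1 h) = J1 (V h)" "\<And>h. h \<in> H \<Longrightarrow> V (T2 h) = J2 (V h)"
    using assms(8) unfolding lifts_def K by blast
  interpret jordan_pair F U1 W1 U2 W2 J1 J2 c d
    using W comm J
    by (simp add: jordan_pair_def jordan_pair_axioms_def unitary_pair_def commuting_inverses_def
        commuting_inverses_axioms_def commute_on_def unitary_operator.axioms(1))
  interpret l: jordan_lift H T1 R1 T2 R2 F U1 W1 U2 W2
    "\<lambda>h. fst (V h)" "\<lambda>h. fst (snd (V h))" "\<lambda>h. snd (snd (V h))" c d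
    by (rule jordan_liftI[OF T V VT])
  \<comment> \<open>The second pair restricts the unitaries to the smallest reducing subspace \<open>E\<close> for which the
    lift takes values in \<open>E \<times> E \<times> E\<close>: it lies in each of the localizations found for the points
    outside the spectrum of \<open>(T1, T2)\<close>.\<close>
  define \<F> where "\<F> = {E. reducing E \<and> (\<forall>h\<in>H. V h \<in> E \<times> E \<times> E)}"
  have V_F: "V h \<in> F \<times> F \<times> F" if "h \<in> H" for h
    using V that by (auto simp: isometry_between_def clinear_between_def)
  then have "F \<in> \<F>" by (simp add: \<F>_def reducing_whole)
  define E where "E = \<Inter> \<F>"
  have E: "reducing E"
    unfolding E_def using \<open>F \<in> \<F>\<close> by (intro reducing_Inter) (auto simp: \<F>_def)
  have V_E: "V h \<in> E \<times> E \<times> E" if "h \<in> H" for h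
    using that by (auto simp: E_def \<F>_def mem_Times_iff)
  then have V': "isometry_between H (E \<times> E \<times> E) V"
    using V by (simp add: isometry_between_def clinear_between_def)
  interpret E: jordan_pair E U1 W1 U2 W2 J1 J2 c d by (rule restrict_to_reducing[OF E])
  have "taylor_spectrum (E \<times> E \<times> E) J1 J2 \<subseteq> taylor_spectrum H T1 T2"
  proof -
    have "koszul_exact (E \<times> E \<times> E) (\<lambda>p. J1 p - z1 *\<^sub>C p) (\<lambda>p. J2 p - z2 *\<^sub>C p)"
      if exact: "koszul_exact H (\<lambda>x. T1 x - z1 *\<^sub>C x) (\<lambda>x. T2 x - z2 *\<^sub>C x)" for z1 z2
    proof -
      obtain E' where E': "reducing E'"
        "\<And>h. h \<in> H \<Longrightarrow> fst (V h) \<in> E' \<and> fst (snd (V h)) \<in> E' \<and> snd (snd (V h)) \<in> E'"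
        "jointly_bounded_below E' (\<lambda>x. U1 x - z1 *\<^sub>C x) (\<lambda>x. U2 x - z2 *\<^sub>C x)"
        using l.koszul_exact_imp_localized[OF exact] by blast
      then have "E \<subseteq> E'" by (auto simp: E_def \<F>_def mem_Times_iff)
      then show ?thesis
        using E'(3) unfolding E.koszul_exact_iff jointly_bounded_below_def by blast
    qed
    then show ?thesis by (auto simp: taylor_spectrum_def)
  qed
  moreover have "taylor_spectrum H T1 T2 \<subseteq> taylor_spectrum (E \<times> E \<times> E) J1 J2"
    by (rule E.taylor_spectrum_subset[OF T V' VT])
  moreover have "lifts H T1 T2 (E \<times> E \<times> E) J1 J2"
    unfolding lifts_def using V' VT by blast
  ultimately show ?thesis
    using taylor_spectrum_subset[OF T V VT] E.in_jordan_class K by blast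
qed

end
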